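(* Let $K$ be a Euclidean imaginary quadratic field with ring of integers $\mathcal O$, $\mathfrak n$ a nonzero ideal of $\mathcal O$, $R$ an $\mathcal O$-algebra, $k\ge2$, and $\eta\in\mathcal O$ nonzero and coprime to $\mathfrak n$. Let $P[u,v]\in R_{k-2}[X,Y][E_{\mathfrak n}]$. Let $\sum_M u_M M\in R[M_2(\mathcal O)_\eta]$ be such that for every class $C\in M_2(\mathcal O)_\eta/SL_2(\mathcal O)$, $$\sum_{M\in C}u_M\big([M\infty]-[M0]\big)=[\infty]-[0]\quad\text{in }R[\mathbf P^1(K)].$$ Then, in $\mathbb M_k(\Gamma_1(\mathfrak n))$, $$T_{\Delta_\eta}([P,(u,v)])=\sum_M u_M\,[P(aX+bY,cX+dY),(au+cv,bu+dv)],$$ where $M=(\begin{smallmatrix}a&b\\c&d\end{smallmatrix})$ and the sum runs over those $M$ with $u_M\neq0$ such that $(au+cv,bu+dv)\in E_{\mathfrak n}$.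
   Context: $\Gamma_1(\mathfrak n)=\{(\begin{smallmatrix}a&b\\c&d\end{smallmatrix})\in SL_2(\mathcal O):c\equiv d-1\equiv0\bmod\mathfrak n\}$. $M_2(\mathcal O)_\eta$ is the set of $2\times2$ matrices over $\mathcal O$ of determinant $\eta$. $\Delta_\eta=\{(\begin{smallmatrix}a&b\\c&d\end{smallmatrix})\in\mathrm{Mat}_2(\mathcal O):ad-bc=\eta,\ c\equiv a-1\equiv0\bmod\mathfrak n\}$. $E_{\mathfrak n}=\{(u,v)\in(\mathcal O/\mathfrak n)^2:u\mathcal O+v\mathcal O=\mathcal O/\mathfrak n\}$; $R_{k-2}[X,Y][E_{\mathfrak n}]$ is the space of formal linear combinations of elements of $E_{\mathfrak n}$ with coefficients in $R_{k-2}[X,Y]$ (homogeneous polynomials of degree $k-2$ over $R$). Modular symbols: $\mathbb M_k(\Gamma)$ is $R_{k-2}[X,Y]\otimes\mathbb M$, with $\mathbb M$ generated by $\{\alpha,\beta\}$, $\alpha,\beta\in\mathbf P^1(K)$, modulo $\{\alpha,\alpha\}=0$, $\{\alpha,\beta\}+\{\beta,\gamma\}+\{\gamma,\alpha\}=0$, taken modulo $x|_\gamma=x$ ($\gamma\in\Gamma$), where $(P\otimes\{\alpha,\beta\})|_g=P|_g\otimes\{g\alpha,g\beta\}$ and $P|_g(X,Y)=P(dX-bY,-cX+aY)$ for $g=(\begin{smallmatrix}a&b\\c&d\end{smallmatrix})$. For $h\in SL_2(\mathcal O)$ the Manin symbol is $[P,h]=P|_h\otimes\{h0,h\infty\}\in\mathbb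 M_k(\Gamma_1(\mathfrak n))$; for $(u,v)\in E_{\mathfrak n}$, $[P,(u,v)]$ denotes $[P,h]$ for any $h\in SL_2(\mathcal O)$ whose bottom row $(0,1)h$ reduces to $(u,v)$ modulo $\mathfrak n$ (this depends only on $(u,v)$ since such $h$ form one coset $\Gamma_1(\mathfrak n)h$). The Hecke operator $T_{\Delta_\eta}$ on $\mathbb M_k(\Gamma_1(\mathfrak n))$ is $P\otimes\{\alpha,\beta\}\mapsto\sum_{\delta}P|_\delta\otimes\{\delta\alpha,\delta\beta\}$, $\delta$ running over representatives of $\Gamma_1(\mathfrak n)\backslash\Delta_\eta$. *)

theory Defs
  imports
    "HOL-Analysis.Determinants"
    "HOL-Library.Poly_Mapping"
    "HOL-Computational_Algebra.Polynomial"
    "HOL-Algebra.Ring_Divisibility"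
    "HOL-Algebra.Module"
    "HOL-Algebra.Generated_Groups"
begin

section \<open>Imaginary quadratic fields and their rings of integers\<close>

text \<open>The field \<open>K\<close> is the whole type \<open>'k\<close>; the condition says \<open>K = \<rat>(\<surd>(-d))\<close> with \<open>d > 0\<close>.\<close>

definition imaginary_quadratic_field :: "'k::field_char_0 itself \<Rightarrow> bool" where
  "imaginary_quadratic_field _ \<longleftrightarrow>
     (\<exists>d::nat. d > 0 \<and> (\<exists>w::'k. w\<^sup>2 = - of_nat d \<and>
        (\<forall>x::'k. \<exists>p q :: rat. x = of_rat p + of_rat q * w)))"

definition set_ring :: "'a::comm_ring_1 set \<Rightarrow> 'a ring" where
  "set_ring S = \<lparr>carrier = S, mult = (*), one = 1, zero = 0, add = (+)\<rparr>"

definition int_ring :: "'k::field_char_0 ring" where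
  "int_ring = set_ring {x. algebraic_int x}"

section \<open>Sets of matrices\<close>

definition mat_det :: "'k::field_char_0 \<Rightarrow> ('k^2^2) set" where
  "mat_det \<eta> = {M. (\<forall>i j. M$i$j \<in> carrier int_ring) \<and> det M = \<eta>}"

abbreviation SL2 :: "('k::field_char_0^2^2) set" where
  "SL2 \<equiv> mat_det 1"

definition Gamma1 :: "'k::field_char_0 set \<Rightarrow> ('k^2^2) set" where
  "Gamma1 \<nn> = {M \<in> SL2. M$2$1 \<in> \<nn> \<and> M$2$2 - 1 \<in> \<nn>}"

definition Delta :: "'k::field_char_0 set \<Rightarrow> 'k \<Rightarrow> ('k^2^2) set" where
  "Delta \<nn> \<eta> = {M \<in> mat_det \<eta>. M$2$1 \<in> \<nn> \<and> M$1$1 - 1 \<in> \<nn>}"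

definition left_quotient :: "('k::field_char_0^2^2) set \<Rightarrow> ('k^2^2) set \<Rightarrow> ('k^2^2) set set" where
  "left_quotient \<Gamma> D = (\<lambda>\<delta>. (\<lambda>\<gamma>. \<gamma> ** \<delta>) ` \<Gamma>) ` D"

definition right_quotient :: "('k::field_char_0^2^2) set \<Rightarrow> ('k^2^2) set \<Rightarrow> ('k^2^2) set set" where
  "right_quotient D \<Gamma> = (\<lambda>\<delta>. (\<lambda>\<gamma>. \<delta> ** \<gamma>) ` \<Gamma>) ` D"

section \<open>The set of unimodular rows modulo an ideal\<close>

definition E_set :: "'k::field_char_0 set \<Rightarrow> ('k set \<times> 'k set) set" where
  "E_set \<nn> = (let Q = int_ring Quot \<nn> in
     {(u, v). u \<in> carrier Q \<and> v \<in> carrier Q \<and>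
        PIdl\<^bsub>Q\<^esub> u <+>\<^bsub>Q\<^esub> PIdl\<^bsub>Q\<^esub> v = carrier Q})"

abbreviation residue :: "'k::field_char_0 set \<Rightarrow> 'k \<Rightarrow> 'k set" where
  "residue \<nn> x \<equiv> \<nn> +>\<^bsub>int_ring\<^esub> x"

definition row_mult ::
  "'k::field_char_0 set \<Rightarrow> 'k set \<times> 'k set \<Rightarrow> 'k^2^2 \<Rightarrow> 'k set \<times> 'k set" where
  "row_mult \<nn> uv M = (let Q = int_ring Quot \<nn> in
     (residue \<nn> (M$1$1) \<otimes>\<^bsub>Q\<^esub> fst uv \<oplus>\<^bsub>Q\<^esub> residue \<nn> (M$2$1) \<otimes>\<^bsub>Q\<^esub> snd uv,
      residue \<nn> (M$1$2) \<otimes>\<^bsub>Q\<^esub> fst uv \<oplus>\<^bsub>Q\<^esub> residue \<nn> (M$2$2) \<otimes>\<^bsub>Q\<^esub> snd uv))"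

section \<open>The projective line\<close>

text \<open>\<open>Some z\<close> is the point \<open>(z : 1)\<close> and \<open>None\<close> is \<open>\<infinity> = (1 : 0)\<close>.\<close>

type_synonym 'k P1 = "'k option"

abbreviation P1_zero :: "'k::field_char_0 P1" where "P1_zero \<equiv> Some 0"
abbreviation P1_inf :: "'k::field_char_0 P1" where "P1_inf \<equiv> None"

definition moebius :: "'k::field_char_0^2^2 \<Rightarrow> 'k P1 \<Rightarrow> 'k P1" where
  "moebius M z = (case z of
     Some x \<Rightarrow> (if M$2$1 * x + M$2$2 = 0 then None
                else Some ((M$1$1 * x + M$1$2) / (M$2$1 * x + M$2$2)))
   | None \<Rightarrow> (if M$2$1 = 0 then None else Some (M$1$1 / M$2$1)))"

section \<open>Polynomials in two variables\<close>

text \<open>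
  \<open>R[X, Y]\<close> is \<open>'r poly poly\<close>, with \<open>X\<close> the inner and \<open>Y\<close> the outer variable.
  The structure map of the \<open>\<O>\<close>-algebra \<open>R\<close> is an explicit argument \<open>\<rho>\<close>.
\<close>

definition hom_polys :: "nat \<Rightarrow> 'r::comm_ring_1 poly poly set" where
  "hom_polys n = {P. \<forall>i j. poly.coeff (poly.coeff P j) i \<noteq> 0 \<longrightarrow> i + j = n}"

definition const2 :: "'r::comm_ring_1 \<Rightarrow> 'r poly poly" where
  "const2 r = [:[:r:]:]"

definition var_X :: "'r::comm_ring_1 poly poly" where
  "var_X = [:[:0, 1:]:]"

definition var_Y :: "'r::comm_ring_1 poly poly" where
  "var_Y = [:0, 1:]"

definition subst2 ::
  "'r::comm_ring_1 poly poly \<Rightarrow> 'r poly poly \<Rightarrow> 'r poly poly \<Rightarrow> 'r poly poly" where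
  "subst2 P A B = (\<Sum>j\<le>degree P. \<Sum>i\<le>degree (poly.coeff P j).
     const2 (poly.coeff (poly.coeff P j) i) * A ^ i * B ^ j)"

definition lin_form :: "('k \<Rightarrow> 'r::comm_ring_1) \<Rightarrow> 'k \<Rightarrow> 'k \<Rightarrow> 'r poly poly" where
  "lin_form \<rho> a b = const2 (\<rho> a) * var_X + const2 (\<rho> b) * var_Y"

definition poly_slash ::
  "('k::field_char_0 \<Rightarrow> 'r::comm_ring_1) \<Rightarrow> 'k^2^2 \<Rightarrow> 'r poly poly \<Rightarrow> 'r poly poly" where
  "poly_slash \<rho> g P =
     subst2 P (lin_form \<rho> (g$2$2) (- g$1$2)) (lin_form \<rho> (- g$2$1) (g$1$1))"

section \<open>Modular symbols\<close>

text \<open>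
  The quotient of a module by a submodule; addition and multiplication of cosets are those
  of \<^const>\<open>FactRing\<close>. The ring multiplication and unit in a record of type
  \<^typ>\<open>('r, 'm) module\<close> have no meaning for a module.
\<close>

definition quot_module :: "('r, 'm) module \<Rightarrow> 'm set \<Rightarrow> ('r, 'm set) module" where
  "quot_module A N =
     \<lparr>carrier = a_rcosets\<^bsub>A\<^esub> N, mult = rcoset_mult A N, one = N +>\<^bsub>A\<^esub> \<one>\<^bsub>A\<^esub>,
      zero = N, add = set_add A,
      smult = (\<lambda>r C. \<Union>x\<in>C. N +>\<^bsub>A\<^esub> (r \<odot>\<^bsub>A\<^esub> x))\<rparr>"

text \<open>
  A finitely supported function \<open>x\<close> stands for the formal sum of the
  \<open>x(\<alpha>, \<beta>) \<otimes> {\<alpha>, \<beta>}\<close>, so \<open>pre_symbols n\<close> is the tensor product over \<open>\<int>\<close> of the homogeneous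
  polynomials of degree \<open>n\<close> with the free abelian group on all pairs \<open>(\<alpha>, \<beta>)\<close>.
\<close>

type_synonym ('k, 'r) pre_symbol = "('k P1 \<times> 'k P1) \<Rightarrow>\<^sub>0 'r poly poly"

definition symb :: "'r::comm_ring_1 poly poly \<Rightarrow> 'k P1 \<Rightarrow> 'k P1 \<Rightarrow> ('k, 'r) pre_symbol" where
  "symb P \<alpha> \<beta> = Poly_Mapping.single (\<alpha>, \<beta>) P"

definition pre_symbols :: "nat \<Rightarrow> ('r::comm_ring_1, ('k::field_char_0, 'r) pre_symbol) module" where
  "pre_symbols n =
     \<lparr>carrier = {x. \<forall>s. Poly_Mapping.lookup x s \<in> hom_polys n},
      mult = undefined, one = undefined, zero = 0, add = (+),
      smult = (\<lambda>r. Poly_Mapping.map ((*) (const2 r)))\<rparr>"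

definition symbol_slash ::
  "('k::field_char_0 \<Rightarrow> 'r::comm_ring_1) \<Rightarrow> 'k^2^2 \<Rightarrow> ('k, 'r) pre_symbol \<Rightarrow> ('k, 'r) pre_symbol" where
  "symbol_slash \<rho> g x = (\<Sum>(\<alpha>, \<beta>)\<in>Poly_Mapping.keys x.
     symb (poly_slash \<rho> g (Poly_Mapping.lookup x (\<alpha>, \<beta>))) (moebius g \<alpha>) (moebius g \<beta>))"

text \<open>
  The generators are closed under scalar multiplication, as \<open>P\<close> and \<open>x\<close> are arbitrary, so the
  additive subgroup they generate is the submodule they generate.
\<close>

definition symbol_relations ::
  "('k::field_char_0 \<Rightarrow> 'r::comm_ring_1) \<Rightarrow> nat \<Rightarrow> ('k^2^2) set \<Rightarrow> ('k, 'r) pre_symbol set" where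
  "symbol_relations \<rho> k \<Gamma> = generate (add_monoid (pre_symbols (k - 2)))
     ({symb P \<alpha> \<alpha> | P \<alpha>. P \<in> hom_polys (k - 2)}
      \<union> {symb P \<alpha> \<beta> + symb P \<beta> \<gamma> + symb P \<gamma> \<alpha> | P \<alpha> \<beta> \<gamma>. P \<in> hom_polys (k - 2)}
      \<union> {symbol_slash \<rho> g x - x | g x. g \<in> \<Gamma> \<and> x \<in> carrier (pre_symbols (k - 2))})"

definition modular_symbols ::
  "('k::field_char_0 \<Rightarrow> 'r::comm_ring_1) \<Rightarrow> nat \<Rightarrow> ('k^2^2) set \<Rightarrow>
     ('r, ('k, 'r) pre_symbol set) module" where
  "modular_symbols \<rho> k \<Gamma> = quot_module (pre_symbols (k - 2)) (symbol_relations \<rho> k \<Gamma>)"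

definition symbol_class ::
  "('k::field_char_0 \<Rightarrow> 'r::comm_ring_1) \<Rightarrow> nat \<Rightarrow> ('k^2^2) set \<Rightarrow>
     ('k, 'r) pre_symbol \<Rightarrow> ('k, 'r) pre_symbol set" where
  "symbol_class \<rho> k \<Gamma> x = symbol_relations \<rho> k \<Gamma> +>\<^bsub>pre_symbols (k - 2)\<^esub> x"

section \<open>Manin symbols\<close>

definition manin_symbol ::
  "('k::field_char_0 \<Rightarrow> 'r::comm_ring_1) \<Rightarrow> nat \<Rightarrow> 'k set \<Rightarrow> 'r poly poly \<Rightarrow> 'k^2^2 \<Rightarrow>
     ('k, 'r) pre_symbol set" where
  "manin_symbol \<rho> k \<nn> P h =
     symbol_class \<rho> k (Gamma1 \<nn>)
       (symb (poly_slash \<rho> h P) (moebius h P1_zero) (moebius h P1_inf))"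

definition manin_symbol_row ::
  "('k::field_char_0 \<Rightarrow> 'r::comm_ring_1) \<Rightarrow> nat \<Rightarrow> 'k set \<Rightarrow> 'r poly poly \<Rightarrow> 'k set \<times> 'k set \<Rightarrow>
     ('k, 'r) pre_symbol set" where
  "manin_symbol_row \<rho> k \<nn> P uv =
     manin_symbol \<rho> k \<nn> P (SOME h. h \<in> SL2 \<and> (residue \<nn> (h$2$1), residue \<nn> (h$2$2)) = uv)"

section \<open>Hecke operators\<close>

text \<open>
  The sum over coset representatives acts on representatives of modular symbols; on a class
  \<open>C\<close> the operator is the union of the (coinciding) classes of the images of the elements of \<open>C\<close>.
\<close>

definition hecke_pre ::
  "('k::field_char_0 \<Rightarrow> 'r::comm_ring_1) \<Rightarrow> 'k set \<Rightarrow> 'k \<Rightarrow>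
     ('k, 'r) pre_symbol \<Rightarrow> ('k, 'r) pre_symbol" where
  "hecke_pre \<rho> \<nn> \<eta> x =
     (\<Sum>D\<in>left_quotient (Gamma1 \<nn>) (Delta \<nn> \<eta>). symbol_slash \<rho> (SOME \<delta>. \<delta> \<in> D) x)"

definition hecke ::
  "('k::field_char_0 \<Rightarrow> 'r::comm_ring_1) \<Rightarrow> nat \<Rightarrow> 'k set \<Rightarrow> 'k \<Rightarrow>
     ('k, 'r) pre_symbol set \<Rightarrow> ('k, 'r) pre_symbol set" where
  "hecke \<rho> k \<nn> \<eta> C = (\<Union>x\<in>C. symbol_class \<rho> k (Gamma1 \<nn>) (hecke_pre \<rho> \<nn> \<eta> x))"

end

theory Submission
  imports Defs
begin

text \<open>
  Let \<open>h\<close> be a matrix in \<open>SL2\<close> with bottom row \<open>(u, v)\<close>, and write \<open>M'\<close> for the adjugate of \<open>M\<close>, so that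
  \<open>P(aX + bY, cX + dY)\<close> is \<open>P\<close> slashed with \<open>M'\<close>. If \<open>(u, v) M\<close> is unimodular modulo \<open>\<nn>\<close> and \<open>g\<close> in
  \<open>SL2\<close> lifts it, then \<open>\<delta> = g M' h\<inverse>\<close> lies in \<open>Delta\<close>, and since \<open>g = \<delta> h M\<close> up to a scalar, the summand
  belonging to \<open>M\<close> is \<open>u\<^sub>M Q \<otimes> {\<delta> h M 0, \<delta> h M \<infinity>}\<close> with \<open>Q = P|\<^sub>\<delta>\<^sub>h\<close>. The matrices \<open>M\<close> that lead to a given coset
  \<open>\<Gamma>\<^sub>1(\<nn>) \<delta>\<close> are those in the class \<open>h\<inverse> \<delta>' SL2\<close>. By the hypothesis on this class their summands add up to
  \<open>Q \<otimes> {\<delta> h 0, \<delta> h \<infinity>}\<close>, the term of the Hecke operator belonging to \<open>\<delta>\<close>. The hypothesis also forces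
  every such class to meet the finite set of \<open>M\<close> with \<open>u\<^sub>M \<noteq> 0\<close>, so there are only finitely many cosets.
\<close>

section \<open>Substitution in polynomials\<close>

text \<open>Substitution of \<open>A\<close> for the inner variable \<open>X\<close>, written as
  evaluation of a polynomial. In this form it is seen to be a ring homomorphism by recursion along
  \<open>pCons\<close>, and \<open>subst2\<close>, a double sum with bounds that depend on degrees,
  inherits this through \<open>subst2_eval1\<close>.\<close>

definition eval1 :: "'r::comm_ring_1 poly poly \<Rightarrow> 'r poly \<Rightarrow> 'r poly poly" where
  "eval1 A p = poly (map_poly const2 p) A"

lemma const2_hom [simp]:
  "const2 0 = 0" "const2 1 = 1" "const2 (r + s) = const2 r + const2 s"
  "const2 (r * s) = const2 r * const2 s" "const2 (- r) = - const2 r"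
  by (simp_all add: const2_def flip: one_pCons)

lemma eval1_pCons [simp]: "eval1 A (pCons r p) = const2 r + A * eval1 A p"
  by (simp add: eval1_def map_poly_pCons)

lemma eval1_0 [simp]: "eval1 A 0 = 0"
  by (simp add: eval1_def)

lemma eval1_1 [simp]: "eval1 A 1 = 1"
  using eval1_pCons[of A 1 0] by (simp flip: one_pCons)

lemma eval1_add [simp]: "eval1 A (p + q) = eval1 A p + eval1 A q"
  by (induction p q rule: poly_induct2) (simp_all add: algebra_simps)

lemma eval1_smult [simp]: "eval1 A (Polynomial.smult r p) = const2 r * eval1 A p"
  by (induction p) (simp_all add: algebra_simps)

lemma eval1_mult [simp]: "eval1 A (p * q) = eval1 A p * eval1 A q"
  by (induction p) (simp_all add: algebra_simps)

lemma subst2_eval1: "subst2 P A B = poly (map_poly (eval1 A) P) B"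
proof -
  have e: "eval1 A p = (\<Sum>i\<le>degree p. const2 (poly.coeff p i) * A ^ i)" for p
  proof -
    have "degree (map_poly const2 p) = degree p"
      by (rule degree_map_poly) (simp add: const2_def)
    then show ?thesis
      by (simp add: eval1_def poly_altdef coeff_map_poly)
  qed
  have "poly (map_poly (eval1 A) P) B
      = (\<Sum>j\<le>degree P. eval1 A (poly.coeff P j) * B ^ j)"
  proof -
    \<comment> \<open>\<open>eval1 A\<close> may send the leading coefficient to 0, so the degree
      can drop; the terms beyond it vanish.\<close>
    have "degree (map_poly (eval1 A) P) \<le> degree P"
      by (rule map_poly_degree_leq)
    then have "poly (map_poly (eval1 A) P) B
        = (\<Sum>j\<le>degree P. poly.coeff (map_poly (eval1 A) P) j * B ^ j)"
      unfolding poly_altdef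
      by (intro sum.mono_neutral_left) (auto simp: coeff_eq_0)
    then show ?thesis by (simp add: coeff_map_poly)
  qed
  then show ?thesis
    by (simp add: subst2_def e sum_distrib_right)
qed

lemma subst2_0 [simp]: "subst2 0 A B = 0"
  by (simp add: subst2_eval1)

lemma subst2_pCons [simp]: "subst2 (pCons p P) A B = eval1 A p + B * subst2 P A B"
  by (simp add: subst2_eval1 map_poly_pCons)

lemma subst2_add [simp]: "subst2 (P + Q) A B = subst2 P A B + subst2 Q A B"
  by (induction P Q rule: poly_induct2) (simp_all add: algebra_simps)

lemma subst2_smult: "subst2 (Polynomial.smult p P) A B = eval1 A p * subst2 P A B"
  by (induction P) (simp_all add: algebra_simps)

lemma subst2_mult [simp]: "subst2 (P * Q) A B = subst2 P A B * subst2 Q A B"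
  by (induction P) (simp_all add: algebra_simps subst2_smult)

lemma subst2_const2 [simp]: "subst2 (const2 r) A B = const2 r"
  by (simp add: const2_def[of r])

lemma subst2_1 [simp]: "subst2 1 A B = 1"
  using subst2_const2[of 1 A B] by simp

lemma subst2_power [simp]: "subst2 (P ^ n) A B = subst2 P A B ^ n"
  by (induction n) simp_all

lemma subst2_sum [simp]: "subst2 (sum f S) A B = (\<Sum>x\<in>S. subst2 (f x) A B)"
  by (induction S rule: infinite_finite_induct) simp_all

lemma subst2_lin_form [simp]:
  "subst2 (lin_form \<rho> a b) A B = const2 (\<rho> a) * A + const2 (\<rho> b) * B"
  by (simp add: lin_form_def) (simp add: var_X_def var_Y_def)

text \<open>Substituting \<open>C\<close> and \<open>D\<close> is a ring homomorphism that fixes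
  constants, so it passes through the double sum that defines the inner substitution.\<close>

lemma subst2_subst2:
  "subst2 (subst2 P A B) C D = subst2 P (subst2 A C D) (subst2 B C D)"
  by (simp add: subst2_def[of P])

section \<open>Homogeneous polynomials under linear substitution\<close>

lemma hom_polys_0 [simp]: "0 \<in> hom_polys n"
  by (simp add: hom_polys_def)

lemma hom_polys_add [intro]: "P \<in> hom_polys n \<Longrightarrow> Q \<in> hom_polys n \<Longrightarrow> P + Q \<in> hom_polys n"
  unfolding hom_polys_def by (auto, metis add_0)

lemma hom_polys_uminus [intro]: "P \<in> hom_polys n \<Longrightarrow> - P \<in> hom_polys n"
  by (simp add: hom_polys_def)

lemma hom_polys_sum:
  "(\<And>x. x \<in> S \<Longrightarrow> f x \<in> hom_polys n) \<Longrightarrow> sum f S \<in> hom_polys n"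
  by (induction S rule: infinite_finite_induct) auto

lemma hom_polys_mult:
  assumes "P \<in> hom_polys m" "Q \<in> hom_polys n"
  shows "P * Q \<in> hom_polys (m + n)"
  unfolding hom_polys_def
proof (clarify)
  fix i j assume "poly.coeff (poly.coeff (P * Q) j) i \<noteq> 0"
  then obtain j' i' where "j' \<le> j" "i' \<le> i"
    and nz: "poly.coeff (poly.coeff P j') i' * poly.coeff (poly.coeff Q (j - j')) (i - i') \<noteq> 0"
    by (auto simp: coeff_mult coeff_sum elim!: sum.not_neutral_contains_not_neutral)
  from nz have "poly.coeff (poly.coeff P j') i' \<noteq> 0" "poly.coeff (poly.coeff Q (j - j')) (i - i') \<noteq> 0"
    by (metis mult_zero_left, metis mult_zero_right)
  then have "i' + j' = m" "(i - i') + (j - j') = n"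
    using assms by (auto simp: hom_polys_def)
  with \<open>j' \<le> j\<close> \<open>i' \<le> i\<close> show "i + j = m + n" by simp
qed

lemma const2_hom_polys: "const2 r \<in> hom_polys 0"
  by (auto simp: hom_polys_def const2_def coeff_pCons split: nat.splits)

lemma hom_polys_const2_mult: "P \<in> hom_polys n \<Longrightarrow> const2 r * P \<in> hom_polys n"
  using hom_polys_mult[OF const2_hom_polys] by force

lemma lin_form_hom_polys: "lin_form \<rho> a b \<in> hom_polys 1"
  unfolding lin_form_def
  by (intro hom_polys_add hom_polys_const2_mult)
    (auto simp: hom_polys_def var_X_def var_Y_def coeff_pCons split: nat.splits if_splits)

lemma hom_polys_power: "A \<in> hom_polys 1 \<Longrightarrow> A ^ n \<in> hom_polys n"
proof (induction n)
  case 0 then show ?case using const2_hom_polys[of 1] by simp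
next
  case (Suc n) then show ?case using hom_polys_mult[of A 1 "A ^ n" n] by simp
qed

text \<open>In the term with exponents \<open>i\<close> and \<open>j\<close> a nonzero coefficient
  forces \<open>i + j = n\<close>, and the term is then a constant times a product of
  \<open>n\<close> linear forms.\<close>

lemma subst2_hom_polys:
  assumes "P \<in> hom_polys n" "A \<in> hom_polys 1" "B \<in> hom_polys 1"
  shows "subst2 P A B \<in> hom_polys n"
  unfolding subst2_def
proof (intro hom_polys_sum)
  fix i j
  show "const2 (poly.coeff (poly.coeff P j) i) * A ^ i * B ^ j \<in> hom_polys n"
  proof (cases "poly.coeff (poly.coeff P j) i = 0")
    case False
    then have "i + j = n" using assms(1) by (simp add: hom_polys_def)
    then show ?thesis
      using hom_polys_mult[OF hom_polys_const2_mult[OF hom_polys_power[OF assms(2)]]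
          hom_polys_power[OF assms(3)]] by metis
  qed simp
qed

lemma poly_slash_hom_polys: "P \<in> hom_polys n \<Longrightarrow> poly_slash \<rho> g P \<in> hom_polys n"
  unfolding poly_slash_def by (intro subst2_hom_polys lin_form_hom_polys)

lemma poly_slash_add [simp]: "poly_slash \<rho> g (P + Q) = poly_slash \<rho> g P + poly_slash \<rho> g Q"
  by (simp add: poly_slash_def)

lemma poly_slash_0 [simp]: "poly_slash \<rho> g 0 = 0"
  by (simp add: poly_slash_def)

lemma poly_slash_const2_mult: "poly_slash \<rho> g (const2 r * P) = const2 r * poly_slash \<rho> g P"
  by (simp add: poly_slash_def)

section \<open>Adjugates and the projective line\<close>

text \<open>The adjugate stands in for the inverse: it stays integral, reverses products, and
  inverts up to the determinant, a scalar that acts trivially on the projective line when it is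
  nonzero.\<close>

definition adj2 :: "'a::comm_ring_1^2^2 \<Rightarrow> 'a^2^2" where
  "adj2 M = vector [vector [M$2$2, - M$1$2], vector [- M$2$1, M$1$1]]"

lemma adj2_nth [simp]:
  "adj2 M $ 1 $ 1 = M$2$2" "adj2 M $ 1 $ 2 = - M$1$2"
  "adj2 M $ 2 $ 1 = - M$2$1" "adj2 M $ 2 $ 2 = M$1$1"
  by (simp_all add: adj2_def)

lemma mult2_nth:
  fixes A B :: "'a::comm_ring_1^2^2"
  shows "(A ** B) $ i $ j = A$i$1 * B$1$j + A$i$2 * B$2$j"
  by (simp add: matrix_matrix_mult_def UNIV_2)

lemma eq_mat2_iff:
  "(A :: 'a^2^2) = B \<longleftrightarrow> A$1$1 = B$1$1 \<and> A$1$2 = B$1$2 \<and> A$2$1 = B$2$1 \<and> A$2$2 = B$2$2"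
  by (auto simp: vec_eq_iff forall_2)

lemma adj2_mult: "adj2 (A ** B) = adj2 B ** adj2 A"
  by (simp add: eq_mat2_iff mult2_nth)

lemma adj2_adj2 [simp]: "adj2 (adj2 M) = M"
  by (simp add: eq_mat2_iff)

lemma det_adj2 [simp]: "det (adj2 M) = det M"
  by (simp add: det_2)

lemma adj2_inverse:
  fixes M :: "'a::comm_ring_1^2^2"
  assumes "det M = 1"
  shows "M ** adj2 M = mat 1" "adj2 M ** M = mat 1"
  using assms by (simp_all add: eq_mat2_iff mult2_nth det_2 mat_def algebra_simps)

text \<open>Homogeneous coordinates \<open>(x : y)\<close> for the \<open>option\<close> encoding.
  In them the action of a matrix is linear, without cases for infinity and vanishing
  denominators.\<close>

definition homog :: "'k::field_char_0 \<Rightarrow> 'k \<Rightarrow> 'k P1" where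
  "homog x y = (if y = 0 then None else Some (x / y))"

lemma P1_homog:
  obtains x y where "z = homog x y" "(x, y) \<noteq> (0, 0)"
proof (cases z)
  case None
  then show ?thesis using that[of 1 0] by (simp add: homog_def)
next
  case (Some a)
  then show ?thesis using that[of a 1] by (simp add: homog_def)
qed

lemma moebius_homog:
  assumes "(x, y) \<noteq> (0, 0)"
  shows "moebius M (homog x y) = homog (M$1$1 * x + M$1$2 * y) (M$2$1 * x + M$2$2 * y)"
proof (cases "y = 0")
  case True
  then show ?thesis using assms by (simp add: homog_def moebius_def)
next
  case False
  then have *: "M$i$1 * (x / y) + M$i$2 = (M$i$1 * x + M$i$2 * y) / y" for i
    by (simp add: field_simps)
  show ?thesis using False unfolding homog_def moebius_def
    by (simp only: option.case if_False *) simp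
qed

lemma moebius_mult:
  assumes "det N \<noteq> 0"
  shows "moebius (M ** N) z = moebius M (moebius N z)"
proof -
  obtain x y where z: "z = homog x y" and nz: "(x, y) \<noteq> (0, 0)"
    by (rule P1_homog)
  let ?x = "N$1$1 * x + N$1$2 * y" and ?y = "N$2$1 * x + N$2$2 * y"
  \<comment> \<open>The adjugate of \<open>N\<close> recovers \<open>(x, y)\<close> from the image
    vector up to the factor \<open>det N\<close>. So the image vector is nonzero and
    \<open>moebius_homog\<close> applies a second time.\<close>
  have "det N * x = N$2$2 * ?x - N$1$2 * ?y" "det N * y = N$1$1 * ?y - N$2$1 * ?x"
    by (simp_all add: det_2 algebra_simps)
  with assms nz have "(?x, ?y) \<noteq> (0, 0)" by auto
  with nz show ?thesis
    by (simp add: z moebius_homog mult2_nth algebra_simps)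
qed

text \<open>\<open>adj2 M ** M\<close> is the scalar matrix \<open>det M\<close>, and rescaling
  homogeneous coordinates by a nonzero factor fixes the point.\<close>

lemma moebius_adj2_cancel:
  assumes "det M \<noteq> 0"
  shows "moebius (adj2 M) (moebius M z) = z"
proof -
  obtain x y where z: "z = homog x y" and nz: "(x, y) \<noteq> (0, 0)"
    by (rule P1_homog)
  have "moebius (adj2 M ** M) z = homog (det M * x) (det M * y)"
    by (simp add: z moebius_homog[OF nz] mult2_nth det_2 algebra_simps)
  then show ?thesis using assms by (simp add: moebius_mult z homog_def)
qed

section \<open>The action of matrices on symbols\<close>

lemma symb_0 [simp]: "symb 0 \<alpha> \<beta> = 0"
  by (simp add: symb_def)

lemma symb_add: "symb (P + Q) \<alpha> \<beta> = symb P \<alpha> \<beta> + symb Q \<alpha> \<beta>"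
  by (simp add: symb_def single_add)

lemma pre_symbol_eq_sum:
  "x = (\<Sum>(\<alpha>, \<beta>)\<in>Poly_Mapping.keys x. symb (Poly_Mapping.lookup x (\<alpha>, \<beta>)) \<alpha> \<beta>)"
proof (rule poly_mapping_eqI)
  fix s
  have "Poly_Mapping.lookup (\<Sum>t\<in>Poly_Mapping.keys x. Poly_Mapping.single t (Poly_Mapping.lookup x t)) s
     = Poly_Mapping.lookup x s"
    by (cases "s \<in> Poly_Mapping.keys x")
      (simp_all add: lookup_sum lookup_single when_def in_keys_iff)
  then show "Poly_Mapping.lookup x s = Poly_Mapping.lookup
      (\<Sum>(\<alpha>, \<beta>)\<in>Poly_Mapping.keys x. symb (Poly_Mapping.lookup x (\<alpha>, \<beta>)) \<alpha> \<beta>) s"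
    by (simp add: symb_def case_prod_unfold)
qed

lemma pre_symbols_simps [simp]:
  "x \<in> carrier (pre_symbols n) \<longleftrightarrow> (\<forall>s. Poly_Mapping.lookup x s \<in> hom_polys n)"
  "zero (pre_symbols n) = 0"
  "add (pre_symbols n) = (+)"
  "Module.smult (pre_symbols n) r = Poly_Mapping.map ((*) (const2 r))"
  by (simp_all add: pre_symbols_def)

lemma symb_carrier: "P \<in> hom_polys n \<Longrightarrow> symb P \<alpha> \<beta> \<in> carrier (pre_symbols n)"
  by (simp add: symb_def lookup_single when_def)

lemma pre_symbols_add_closed:
  "x \<in> carrier (pre_symbols n) \<Longrightarrow> y \<in> carrier (pre_symbols n) \<Longrightarrow> x + y \<in> carrier (pre_symbols n)"
  by (auto simp: lookup_add)

lemma pre_symbols_uminus_closed: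
  "x \<in> carrier (pre_symbols n) \<Longrightarrow> - x \<in> carrier (pre_symbols n)"
  by auto

text \<open>Every formal sum is a sum of single symbols by \<open>pre_symbol_eq_sum\<close>, so
  additive statements need only be checked on \<open>symb\<close>.\<close>

lemma pre_symbol_induct [consumes 1, case_names zero symb add]:
  assumes x: "x \<in> carrier (pre_symbols n)"
    and zero: "Q 0"
    and symb: "\<And>P \<alpha> \<beta>. P \<in> hom_polys n \<Longrightarrow> Q (symb P \<alpha> \<beta>)"
    and add: "\<And>x y. Q x \<Longrightarrow> Q y \<Longrightarrow> Q (x + y)"
  shows "Q x"
proof -
  have "Q (\<Sum>s\<in>S. symb (Poly_Mapping.lookup x (fst s, snd s)) (fst s) (snd s))" for S
    using x by (induction S rule: infinite_finite_induct) (auto intro: zero symb add)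
  from this[of "Poly_Mapping.keys x"] show ?thesis
    unfolding pre_symbol_eq_sum[of x, symmetric, unfolded case_prod_unfold] .
qed

lemma abelian_group_pre_symbols: "abelian_group (pre_symbols n)"
proof (rule abelian_groupI)
  fix x assume "x \<in> carrier (pre_symbols n)"
  then show "\<exists>y\<in>carrier (pre_symbols n). y \<oplus>\<^bsub>pre_symbols n\<^esub> x = \<zero>\<^bsub>pre_symbols n\<^esub>"
    by (intro bexI[of _ "- x"]) auto
qed (auto simp: lookup_add add_ac)

lemma a_inv_pre_symbols:
  assumes "x \<in> carrier (pre_symbols n)"
  shows "\<ominus>\<^bsub>pre_symbols n\<^esub> x = - x"
proof -
  interpret abelian_group "pre_symbols n :: ('b, ('a,'b) pre_symbol) module"
    by (rule abelian_group_pre_symbols)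
  show ?thesis using assms by (intro minus_equality) auto
qed

text \<open>Cancellation can make the support of \<open>x + y\<close> smaller than the union of the
  supports. Over a common finite superset, where the extra terms are 0, additivity is
  termwise.\<close>

lemma symbol_slash_superset:
  assumes "finite S" "Poly_Mapping.keys x \<subseteq> S"
  shows "symbol_slash \<rho> g x = (\<Sum>s\<in>S. symb (poly_slash \<rho> g (Poly_Mapping.lookup x s))
           (moebius g (fst s)) (moebius g (snd s)))"
  unfolding symbol_slash_def case_prod_unfold prod.collapse
  using assms by (intro sum.mono_neutral_left) (auto simp: in_keys_iff)

lemma symbol_slash_0 [simp]: "symbol_slash \<rho> g 0 = 0"
  by (simp add: symbol_slash_def)

lemma symbol_slash_add: "symbol_slash \<rho> g (x + y) = symbol_slash \<rho> g x + symbol_slash \<rho> g y"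
proof -
  let ?S = "Poly_Mapping.keys x \<union> Poly_Mapping.keys y"
  show ?thesis
    by (simp add: symbol_slash_superset[of ?S] Poly_Mapping.keys_add lookup_add symb_add sum.distrib)
qed

lemma symbol_slash_uminus: "symbol_slash \<rho> g (- x) = - symbol_slash \<rho> g x"
  using symbol_slash_add[of \<rho> g x "- x"] by (simp add: eq_neg_iff_add_eq_0 add.commute)

lemma symbol_slash_symb:
  "symbol_slash \<rho> g (symb P \<alpha> \<beta>) = symb (poly_slash \<rho> g P) (moebius g \<alpha>) (moebius g \<beta>)"
  by (subst symbol_slash_superset[of "{(\<alpha>, \<beta>)}"]) (auto simp: symb_def lookup_single)

lemma symbol_slash_carrier:
  assumes "x \<in> carrier (pre_symbols n)"
  shows "symbol_slash \<rho> g x \<in> carrier (pre_symbols n)"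
  using assms
proof (induction x rule: pre_symbol_induct)
  case (symb P \<alpha> \<beta>)
  then show ?case
    unfolding symbol_slash_symb by (intro symb_carrier poly_slash_hom_polys)
next
  case (add x y)
  then show ?case unfolding symbol_slash_add by (intro pre_symbols_add_closed)
qed simp

definition scale :: "'r::comm_ring_1 \<Rightarrow> ('k, 'r) pre_symbol \<Rightarrow> ('k, 'r) pre_symbol" where
  "scale r = Poly_Mapping.map ((*) (const2 r))"

lemma lookup_scale: "Poly_Mapping.lookup (scale r x) s = const2 r * Poly_Mapping.lookup x s"
  by (simp add: scale_def Poly_Mapping.map.rep_eq when_def)

lemma scale_0 [simp]: "scale r 0 = 0"
  by (rule poly_mapping_eqI) (simp add: lookup_scale)

lemma scale_add: "scale r (x + y) = scale r x + scale r y"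
  by (rule poly_mapping_eqI) (simp add: lookup_scale lookup_add algebra_simps)

lemma scale_diff: "scale r (x - y) = scale r x - scale r y"
  by (rule poly_mapping_eqI) (simp add: lookup_scale lookup_minus algebra_simps)

lemma scale_uminus: "scale r (- x) = - scale r x"
  by (rule poly_mapping_eqI) (simp add: lookup_scale)

lemma scale_symb: "scale r (symb P \<alpha> \<beta>) = symb (const2 r * P) \<alpha> \<beta>"
  by (rule poly_mapping_eqI) (simp add: lookup_scale symb_def lookup_single when_def)

lemma scale_carrier: "x \<in> carrier (pre_symbols n) \<Longrightarrow> scale r x \<in> carrier (pre_symbols n)"
  by (simp add: lookup_scale hom_polys_const2_mult)

lemma symbol_slash_scale:
  assumes "x \<in> carrier (pre_symbols n)"
  shows "symbol_slash \<rho> g (scale r x) = scale r (symbol_slash \<rho> g x)"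
  using assms
proof (induction x rule: pre_symbol_induct)
  case (add x y)
  then show ?case by (simp add: scale_add symbol_slash_add)
qed (simp_all add: scale_symb symbol_slash_symb poly_slash_const2_mult del: subst2_mult)

section \<open>Relations between symbols\<close>

definition symbol_generators ::
  "('k::field_char_0 \<Rightarrow> 'r::comm_ring_1) \<Rightarrow> nat \<Rightarrow> ('k^2^2) set \<Rightarrow> ('k, 'r) pre_symbol set" where
  "symbol_generators \<rho> k \<Gamma> = {symb P \<alpha> \<alpha> | P \<alpha>. P \<in> hom_polys (k - 2)}
      \<union> {symb P \<alpha> \<beta> + symb P \<beta> \<gamma> + symb P \<gamma> \<alpha> | P \<alpha> \<beta> \<gamma>. P \<in> hom_polys (k - 2)}
      \<union> {symbol_slash \<rho> g x - x | g x. g \<in> \<Gamma> \<and> x \<in> carrier (pre_symbols (k - 2))}"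

lemma symbol_relations_generate:
  "symbol_relations \<rho> k \<Gamma> = generate (add_monoid (pre_symbols (k - 2))) (symbol_generators \<rho> k \<Gamma>)"
  by (simp only: symbol_relations_def symbol_generators_def)

lemma symbol_generators_carrier: "symbol_generators \<rho> k \<Gamma> \<subseteq> carrier (pre_symbols (k - 2))"
proof -
  have "symbol_slash \<rho> g x - x \<in> carrier (pre_symbols (k - 2))"
    if "x \<in> carrier (pre_symbols (k - 2))" for g x
    using pre_symbols_add_closed[OF symbol_slash_carrier[OF that] pre_symbols_uminus_closed[OF that]] by simp
  then show ?thesis
    unfolding symbol_generators_def by (blast intro: pre_symbols_add_closed symb_carrier)
qed

lemma additive_subgroup_symbol_relations:
  fixes \<rho> :: "'k::field_char_0 \<Rightarrow> 'r::comm_ring_1"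
  shows "additive_subgroup (symbol_relations \<rho> k \<Gamma>) (pre_symbols (k - 2))"
proof -
  interpret abelian_group "pre_symbols (k - 2) :: ('r, ('k,'r) pre_symbol) module"
    by (rule abelian_group_pre_symbols)
  show ?thesis
    unfolding symbol_relations_generate
    by (intro additive_subgroup.intro add.generate_is_subgroup symbol_generators_carrier)
qed

lemma symbol_relations_carrier:
  "x \<in> symbol_relations \<rho> k \<Gamma> \<Longrightarrow> x \<in> carrier (pre_symbols (k - 2))"
  using additive_subgroup.a_subset[OF additive_subgroup_symbol_relations] by blast

lemma symbol_relations_0: "0 \<in> symbol_relations \<rho> k \<Gamma>"
  unfolding symbol_relations_def using generate.one[of "add_monoid (pre_symbols (k - 2))"] by simp

lemma symbol_relations_add:
  "x \<in> symbol_relations \<rho> k \<Gamma> \<Longrightarrow> y \<in> symbol_relations \<rho> k \<Gamma> \<Longrightarrow> x + y \<in> symbol_relations \<rho> k \<Gamma>"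
  unfolding symbol_relations_def using generate.eng[of _ "add_monoid (pre_symbols (k - 2))"] by simp

lemma symbol_relations_uminus:
  assumes "x \<in> symbol_relations \<rho> k \<Gamma>" shows "- x \<in> symbol_relations \<rho> k \<Gamma>"
  using additive_subgroup.a_inv_closed[OF additive_subgroup_symbol_relations assms]
    a_inv_pre_symbols[OF symbol_relations_carrier[OF assms]] by simp

lemma symbol_relations_diff:
  "x \<in> symbol_relations \<rho> k \<Gamma> \<Longrightarrow> y \<in> symbol_relations \<rho> k \<Gamma> \<Longrightarrow> x - y \<in> symbol_relations \<rho> k \<Gamma>"
  using symbol_relations_add[OF _ symbol_relations_uminus] by fastforce

lemma symbol_relations_sum:
  "(\<And>i. i \<in> I \<Longrightarrow> f i \<in> symbol_relations \<rho> k \<Gamma>) \<Longrightarrow> sum f I \<in> symbol_relations \<rho> k \<Gamma>"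
  by (induction I rule: infinite_finite_induct) (auto intro: symbol_relations_0 symbol_relations_add)

lemma symbol_relations_gens:
  "P \<in> hom_polys (k - 2) \<Longrightarrow> symb P \<alpha> \<alpha> \<in> symbol_relations \<rho> k \<Gamma>"
  "P \<in> hom_polys (k - 2) \<Longrightarrow> symb P \<alpha> \<beta> + symb P \<beta> \<gamma> + symb P \<gamma> \<alpha> \<in> symbol_relations \<rho> k \<Gamma>"
  "g \<in> \<Gamma> \<Longrightarrow> x \<in> carrier (pre_symbols (k - 2)) \<Longrightarrow> symbol_slash \<rho> g x - x \<in> symbol_relations \<rho> k \<Gamma>"
  unfolding symbol_relations_def by (rule generate.incl; blast)+

text \<open>Induction along \<open>generate\<close>, with the operations of the additive monoid
  turned into \<open>+\<close> and unary minus. It serves to show that an additive map preserves the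
  relations.\<close>

lemma symbol_relations_induct [consumes 1, case_names zero symb triangle slash uminus add]:
  fixes \<rho> :: "'k::field_char_0 \<Rightarrow> 'r::comm_ring_1"
  assumes "x \<in> symbol_relations \<rho> k \<Gamma>"
    and zero: "Q 0"
    and symb: "\<And>P \<alpha>. P \<in> hom_polys (k - 2) \<Longrightarrow> Q (symb P \<alpha> \<alpha>)"
    and triangle: "\<And>P \<alpha> \<beta> \<gamma>. P \<in> hom_polys (k - 2) \<Longrightarrow> Q (symb P \<alpha> \<beta> + symb P \<beta> \<gamma> + symb P \<gamma> \<alpha>)"
    and slash: "\<And>g x. g \<in> \<Gamma> \<Longrightarrow> x \<in> carrier (pre_symbols (k - 2)) \<Longrightarrow> Q (symbol_slash \<rho> g x - x)"
    and uminus: "\<And>x. Q x \<Longrightarrow> Q (- x)"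
    and add: "\<And>x y. Q x \<Longrightarrow> Q y \<Longrightarrow> Q (x + y)"
  shows "Q x"
  using assms(1) unfolding symbol_relations_generate
proof (induction rule: generate.induct)
  case one
  then show ?case using zero by simp
next
  case (incl h)
  then show ?case using symb triangle slash unfolding symbol_generators_def by blast
next
  case (inv h)
  \<comment> \<open>The group inverse is known to be unary minus only inside the carrier, which
    contains the relations.\<close>
  then have "h \<in> symbol_relations \<rho> k \<Gamma>"
    unfolding symbol_relations_generate by (rule generate.incl)
  then have "inv\<^bsub>add_monoid (pre_symbols (k - 2))\<^esub> h = - h"
    using a_inv_pre_symbols[OF symbol_relations_carrier] by (simp add: a_inv_def)
  moreover have "Q h"
    using inv symb triangle slash unfolding symbol_generators_def by blast
  ultimately show ?case using uminus by simp
next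
  case (eng h1 h2)
  then show ?case using add by simp
qed

text \<open>Scaling turns each kind of generator into one of the same kind; for the third kind this
  uses that the slash action commutes with scaling.\<close>

lemma symbol_relations_scale:
  assumes "x \<in> symbol_relations \<rho> k \<Gamma>"
  shows "scale r x \<in> symbol_relations \<rho> k \<Gamma>"
  using assms
proof (induction rule: symbol_relations_induct)
  case (symb P \<alpha>)
  then show ?case by (simp add: scale_symb symbol_relations_gens hom_polys_const2_mult)
next
  case (triangle P \<alpha> \<beta> \<gamma>)
  then show ?case by (simp add: scale_symb scale_add symbol_relations_gens hom_polys_const2_mult)
next
  case (slash g x)
  then show ?case
    using symbol_relations_gens(3)[OF slash(1) scale_carrier[OF slash(2)]]
    by (simp add: scale_diff symbol_slash_scale del: pre_symbols_simps(1))
qed (auto simp: scale_add scale_uminus intro: symbol_relations_0 symbol_relations_add symbol_relations_uminus)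

section \<open>Classes of symbols and the module they form\<close>

lemma mem_symbol_class: "y \<in> symbol_class \<rho> k \<Gamma> x \<longleftrightarrow> y - x \<in> symbol_relations \<rho> k \<Gamma>"
  unfolding symbol_class_def a_r_coset_def'
  by (auto simp: intro!: bexI[of _ "y - x"])

lemma symbol_class_eq_iff:
  "symbol_class \<rho> k \<Gamma> x = symbol_class \<rho> k \<Gamma> y \<longleftrightarrow> x - y \<in> symbol_relations \<rho> k \<Gamma>"
proof
  assume "symbol_class \<rho> k \<Gamma> x = symbol_class \<rho> k \<Gamma> y"
  then show "x - y \<in> symbol_relations \<rho> k \<Gamma>"
    using mem_symbol_class[of x \<rho> k \<Gamma> x] mem_symbol_class[of x \<rho> k \<Gamma> y] by (simp add: symbol_relations_0)
next
  assume *: "x - y \<in> symbol_relations \<rho> k \<Gamma>"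
  have "z - x \<in> symbol_relations \<rho> k \<Gamma> \<longleftrightarrow> z - y \<in> symbol_relations \<rho> k \<Gamma>" for z
    using symbol_relations_add[OF _ *, of "z - x"] symbol_relations_diff[OF _ *, of "z - y"] by auto
  then show "symbol_class \<rho> k \<Gamma> x = symbol_class \<rho> k \<Gamma> y"
    by (auto simp: mem_symbol_class)
qed

lemma modular_symbols_carrier:
  "x \<in> carrier (pre_symbols (k - 2)) \<Longrightarrow> symbol_class \<rho> k \<Gamma> x \<in> carrier (modular_symbols \<rho> k \<Gamma>)"
  unfolding modular_symbols_def quot_module_def symbol_class_def A_RCOSETS_def' by auto

lemma modular_symbols_add:
  "symbol_class \<rho> k \<Gamma> x \<oplus>\<^bsub>modular_symbols \<rho> k \<Gamma>\<^esub> symbol_class \<rho> k \<Gamma> y = symbol_class \<rho> k \<Gamma> (x + y)"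
proof -
  have "z \<in> symbol_class \<rho> k \<Gamma> x \<oplus>\<^bsub>modular_symbols \<rho> k \<Gamma>\<^esub> symbol_class \<rho> k \<Gamma> y
     \<longleftrightarrow> (\<exists>a b. z = a + b \<and> a \<in> symbol_class \<rho> k \<Gamma> x \<and> b \<in> symbol_class \<rho> k \<Gamma> y)" for z
    by (auto simp: modular_symbols_def quot_module_def set_add_def')
  moreover have "(\<exists>a b. z = a + b \<and> a \<in> symbol_class \<rho> k \<Gamma> x \<and> b \<in> symbol_class \<rho> k \<Gamma> y)
     \<longleftrightarrow> z \<in> symbol_class \<rho> k \<Gamma> (x + y)" for z
  proof
    assume "\<exists>a b. z = a + b \<and> a \<in> symbol_class \<rho> k \<Gamma> x \<and> b \<in> symbol_class \<rho> k \<Gamma> y"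
    then obtain a b where z: "z = a + b" and ab: "a - x \<in> symbol_relations \<rho> k \<Gamma>"
      "b - y \<in> symbol_relations \<rho> k \<Gamma>" by (auto simp: mem_symbol_class)
    have "z - (x + y) = (a - x) + (b - y)" by (simp add: z algebra_simps)
    then show "z \<in> symbol_class \<rho> k \<Gamma> (x + y)"
      using symbol_relations_add[OF ab] by (simp only: mem_symbol_class)
  next
    assume "z \<in> symbol_class \<rho> k \<Gamma> (x + y)"
    then show "\<exists>a b. z = a + b \<and> a \<in> symbol_class \<rho> k \<Gamma> x \<and> b \<in> symbol_class \<rho> k \<Gamma> y"
      by (intro exI[of _ "z - y"] exI[of _ y]) (simp add: mem_symbol_class symbol_relations_0 algebra_simps)
  qed
  ultimately show ?thesis by blast
qed

text \<open>The scalar multiple in \<open>quot_module\<close> is a union over all representatives.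
  They all contribute the same class since scaling preserves the relations, and there is at least
  one, namely \<open>x\<close>.\<close>

lemma modular_symbols_smult:
  "r \<odot>\<^bsub>modular_symbols \<rho> k \<Gamma>\<^esub> symbol_class \<rho> k \<Gamma> x = symbol_class \<rho> k \<Gamma> (scale r x)"
proof -
  have "r \<odot>\<^bsub>modular_symbols \<rho> k \<Gamma>\<^esub> symbol_class \<rho> k \<Gamma> x
     = (\<Union>y\<in>symbol_class \<rho> k \<Gamma> x. symbol_class \<rho> k \<Gamma> (scale r y))"
    by (simp add: modular_symbols_def quot_module_def symbol_class_def scale_def)
  also have "\<dots> = (\<Union>y\<in>symbol_class \<rho> k \<Gamma> x. symbol_class \<rho> k \<Gamma> (scale r x))"
    by (intro SUP_cong refl)
      (simp add: symbol_class_eq_iff mem_symbol_class symbol_relations_scale flip: scale_diff)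
  also have "\<dots> = symbol_class \<rho> k \<Gamma> (scale r x)"
    using mem_symbol_class[of x \<rho> k \<Gamma> x] symbol_relations_0 by auto
  finally show ?thesis .
qed

lemma modular_symbols_carrierE:
  assumes "C \<in> carrier (modular_symbols \<rho> k \<Gamma>)"
  obtains x where "x \<in> carrier (pre_symbols (k - 2))" "C = symbol_class \<rho> k \<Gamma> x"
  using assms unfolding modular_symbols_def quot_module_def symbol_class_def A_RCOSETS_def' by auto

lemma modular_symbols_zero: "\<zero>\<^bsub>modular_symbols \<rho> k \<Gamma>\<^esub> = symbol_class \<rho> k \<Gamma> 0"
  by (auto simp: modular_symbols_def quot_module_def mem_symbol_class)

lemma abelian_group_modular_symbols: "abelian_group (modular_symbols \<rho> k \<Gamma>)"
proof (rule abelian_groupI)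
  fix C assume "C \<in> carrier (modular_symbols \<rho> k \<Gamma>)"
  then obtain x where x: "x \<in> carrier (pre_symbols (k - 2))" and C: "C = symbol_class \<rho> k \<Gamma> x"
    by (rule modular_symbols_carrierE)
  from x show "\<exists>D\<in>carrier (modular_symbols \<rho> k \<Gamma>).
      D \<oplus>\<^bsub>modular_symbols \<rho> k \<Gamma>\<^esub> C = \<zero>\<^bsub>modular_symbols \<rho> k \<Gamma>\<^esub>"
    by (intro bexI[of _ "symbol_class \<rho> k \<Gamma> (- x)"] modular_symbols_carrier pre_symbols_uminus_closed)
      (simp_all add: C modular_symbols_add modular_symbols_zero)
qed (auto elim!: modular_symbols_carrierE simp: modular_symbols_add modular_symbols_zero add_ac
  simp del: pre_symbols_simps(1) intro!: modular_symbols_carrier pre_symbols_add_closed, simp)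

text \<open>Moves a sum in the quotient to a sum of formal symbols, so that an equation between
  classes becomes membership in the relations.\<close>

lemma finsum_symbol_class:
  fixes \<rho> :: "'k::field_char_0 \<Rightarrow> 'r::comm_ring_1"
  assumes "finite I" "\<And>i. i \<in> I \<Longrightarrow> x i \<in> carrier (pre_symbols (k - 2))"
  shows "(\<Oplus>\<^bsub>modular_symbols \<rho> k \<Gamma>\<^esub>i\<in>I. symbol_class \<rho> k \<Gamma> (x i)) = symbol_class \<rho> k \<Gamma> (\<Sum>i\<in>I. x i)"
proof -
  interpret abelian_group "modular_symbols \<rho> k \<Gamma>"
    by (rule abelian_group_modular_symbols)
  show ?thesis
    using assms
  proof (induction I rule: finite_induct)
    case empty
    then show ?case by (simp add: modular_symbols_zero)
  next
    case (insert i I)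
    then show ?case
      by (subst finsum_insert)
        (auto simp: modular_symbols_add simp del: pre_symbols_simps(1) intro!: modular_symbols_carrier)
  qed
qed

section \<open>Unimodular rows and congruence subgroups\<close>

lemma int_ring_simps [simp]:
  "x \<otimes>\<^bsub>int_ring\<^esub> y = x * y" "x \<oplus>\<^bsub>int_ring\<^esub> y = x + y"
  "\<one>\<^bsub>int_ring\<^esub> = 1" "\<zero>\<^bsub>int_ring\<^esub> = 0"
  by (simp_all add: int_ring_def set_ring_def)

text \<open>The Euclidean property enters through principality, which yields the Bezout identities
  behind the lifting of unimodular rows. The map \<open>\<rho>\<close> is a homomorphism on the ring
  of integers, so integrality of matrix entries is tracked throughout.\<close>

locale modular_setting =
  fixes \<rho> :: "'k::field_char_0 \<Rightarrow> 'r::comm_ring_1" and \<nn> :: "'k set"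
  assumes principal: "principal_domain (int_ring :: 'k ring)"
    and ideal_\<nn>: "ideal \<nn> int_ring"
    and \<rho>_hom: "\<rho> \<in> ring_hom int_ring (set_ring UNIV)"
begin

sublocale O: principal_domain "int_ring :: 'k ring" by (rule principal)

abbreviation \<O> :: "'k set" where "\<O> \<equiv> carrier int_ring"

lemma O_closed [simp, intro]:
  "0 \<in> \<O>" "1 \<in> \<O>" "x \<in> \<O> \<Longrightarrow> y \<in> \<O> \<Longrightarrow> x + y \<in> \<O>" "x \<in> \<O> \<Longrightarrow> y \<in> \<O> \<Longrightarrow> x * y \<in> \<O>"
  using O.zero_closed O.one_closed O.a_closed[of x y] O.m_closed[of x y] by simp_all

lemma O_uminus [simp, intro]: "x \<in> \<O> \<Longrightarrow> - x \<in> \<O>"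
  using O.a_inv_closed[of x] O.l_neg[of x] by (metis add_eq_0_iff2 int_ring_simps(2,4))

lemma \<rho>_simps:
  "\<rho> 1 = 1" "x \<in> \<O> \<Longrightarrow> y \<in> \<O> \<Longrightarrow> \<rho> (x + y) = \<rho> x + \<rho> y"
  "x \<in> \<O> \<Longrightarrow> y \<in> \<O> \<Longrightarrow> \<rho> (x * y) = \<rho> x * \<rho> y"
  using ring_hom_one[OF \<rho>_hom] ring_hom_add[OF \<rho>_hom, of x y] ring_hom_mult[OF \<rho>_hom, of x y]
  by (simp_all add: set_ring_def)

lemma \<rho>_uminus: "x \<in> \<O> \<Longrightarrow> \<rho> (- x) = - \<rho> x"
  using \<rho>_simps(2)[of x "- x"] \<rho>_simps(2)[of 0 0] by (simp add: eq_neg_iff_add_eq_0 add.commute)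

text \<open>A generator \<open>g\<close> of the ideal spanned by \<open>c\<close> and
  \<open>d\<close> is a greatest common divisor, and cancelling it leaves coprime cofactors.\<close>

lemma bezout:
  assumes "c \<in> \<O>" "d \<in> \<O>"
  obtains g c' d' x y where "g \<in> \<O>" "c' \<in> \<O>" "d' \<in> \<O>" "x \<in> \<O>" "y \<in> \<O>"
    "c = g * c'" "d = g * d'" "x * c' + y * d' = 1"
proof (cases "c = 0 \<and> d = 0")
  case True
  \<comment> \<open>Here \<open>g = 0\<close> and nothing can be cancelled, but any coprime pair
    serves as cofactors; \<open>(0, 1)\<close> is taken.\<close>
  then show ?thesis using that[of 0 0 1 0 1] by simp
next
  case False
  obtain g where g: "g \<in> \<O>" and eq: "PIdl\<^bsub>int_ring\<^esub> c <+>\<^bsub>int_ring\<^esub> PIdl\<^bsub>int_ring\<^esub> d = PIdl\<^bsub>int_ring\<^esub> g"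
    using O.exists_gen[OF O.add_ideals[OF O.cgenideal_ideal[OF assms(1)] O.cgenideal_ideal[OF assms(2)]]]
    by blast
  have mem: "z \<in> PIdl\<^bsub>int_ring\<^esub> g \<longleftrightarrow> (\<exists>x\<in>\<O>. \<exists>y\<in>\<O>. z = x * c + y * d)" for z
    unfolding eq[symmetric] unfolding set_add_def' cgenideal_def by auto
  have "g \<in> PIdl\<^bsub>int_ring\<^esub> g" using g by (rule O.cgenideal_self)
  then obtain x y where xy: "x \<in> \<O>" "y \<in> \<O>" "g = x * c + y * d" using mem by blast
  have "c \<in> PIdl\<^bsub>int_ring\<^esub> g" unfolding mem by (intro bexI[of _ 1] bexI[of _ 0]) auto
  then obtain c' where c': "c' \<in> \<O>" "c = g * c'" by (auto simp: cgenideal_def)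
  have "d \<in> PIdl\<^bsub>int_ring\<^esub> g" unfolding mem by (intro bexI[of _ 1] bexI[of _ 0]) auto
  then obtain d' where d': "d' \<in> \<O>" "d = g * d'" by (auto simp: cgenideal_def)
  have "g \<noteq> 0" using False c' d' by auto
  moreover have "g * (x * c' + y * d') = g * 1"
    using xy(3) c'(2) d'(2) by (metis distrib_left mult.left_commute mult.right_neutral)
  ultimately have "x * c' + y * d' = 1" by simp
  then show ?thesis by (rule that[OF g c'(1) d'(1) xy(1,2) c'(2) d'(2)])
qed

section \<open>The ideal \<open>\<nn>\<close> and its residue ring\<close>

lemma \<nn>_closed:
  "0 \<in> \<nn>" "x \<in> \<nn> \<Longrightarrow> y \<in> \<nn> \<Longrightarrow> x + y \<in> \<nn>" "x \<in> \<nn> \<Longrightarrow> a \<in> \<O> \<Longrightarrow> a * x \<in> \<nn>"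
  "x \<in> \<nn> \<Longrightarrow> a \<in> \<O> \<Longrightarrow> x * a \<in> \<nn>" "x \<in> \<nn> \<Longrightarrow> x \<in> \<O>"
proof -
  interpret I: ideal \<nn> int_ring by (rule ideal_\<nn>)
  show "0 \<in> \<nn>" "x \<in> \<nn> \<Longrightarrow> y \<in> \<nn> \<Longrightarrow> x + y \<in> \<nn>" "x \<in> \<nn> \<Longrightarrow> a \<in> \<O> \<Longrightarrow> a * x \<in> \<nn>"
    "x \<in> \<nn> \<Longrightarrow> a \<in> \<O> \<Longrightarrow> x * a \<in> \<nn>" "x \<in> \<nn> \<Longrightarrow> x \<in> \<O>"
    using I.zero_closed I.a_closed[of x y] I.I_l_closed[of x a] I.I_r_closed[of x a] I.Icarr[of x]
    by simp_all
qed

lemma \<nn>_uminus: "x \<in> \<nn> \<Longrightarrow> - x \<in> \<nn>"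
  using \<nn>_closed(3)[of x "- 1"] by simp

lemma \<nn>_diff: "x \<in> \<nn> \<Longrightarrow> y \<in> \<nn> \<Longrightarrow> x - y \<in> \<nn>"
  using \<nn>_closed(2)[OF _ \<nn>_uminus] by fastforce

lemma residue_eq_iff: "residue \<nn> x = residue \<nn> y \<longleftrightarrow> x - y \<in> \<nn>"
proof -
  have mem: "z \<in> residue \<nn> w \<longleftrightarrow> z - w \<in> \<nn>" for z w
    unfolding a_r_coset_def' by (auto intro!: bexI[of _ "z - w"])
  show ?thesis
  proof
    assume "residue \<nn> x = residue \<nn> y"
    then show "x - y \<in> \<nn>" using mem[of x x] mem[of x y] by (simp add: \<nn>_closed)
  next
    assume *: "x - y \<in> \<nn>"
    have "z - x \<in> \<nn> \<longleftrightarrow> z - y \<in> \<nn>" for z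
      using \<nn>_closed(2)[OF _ *, of "z - x"] \<nn>_diff[OF _ *, of "z - y"] by auto
    then show "residue \<nn> x = residue \<nn> y" by (auto simp: mem)
  qed
qed

lemma residue_arith:
  assumes "x \<in> \<O>" "y \<in> \<O>"
  shows "residue \<nn> x \<otimes>\<^bsub>int_ring Quot \<nn>\<^esub> residue \<nn> y = residue \<nn> (x * y)"
    and "residue \<nn> x \<oplus>\<^bsub>int_ring Quot \<nn>\<^esub> residue \<nn> y = residue \<nn> (x + y)"
proof -
  interpret I: ideal \<nn> int_ring by (rule ideal_\<nn>)
  show "residue \<nn> x \<otimes>\<^bsub>int_ring Quot \<nn>\<^esub> residue \<nn> y = residue \<nn> (x * y)"
    "residue \<nn> x \<oplus>\<^bsub>int_ring Quot \<nn>\<^esub> residue \<nn> y = residue \<nn> (x + y)"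
    using assms I.rcoset_mult_add[of x y] I.a_rcos_sum[of x y] by (simp_all add: FactRing_def)
qed

lemma carrier_Quot: "carrier (int_ring Quot \<nn>) = residue \<nn> ` \<O>"
  by (auto simp: FactRing_def A_RCOSETS_def')

text \<open>Principal ideals of the quotient consist of the residues of multiples, so the two ideals
  sum to the whole ring exactly when 1 is congruent to a combination of the lifts.\<close>

lemma E_set_iff:
  "(u, v) \<in> E_set \<nn> \<longleftrightarrow> (\<exists>x\<in>\<O>. \<exists>y\<in>\<O>. u = residue \<nn> x \<and> v = residue \<nn> y \<and>
     (\<exists>s\<in>\<O>. \<exists>t\<in>\<O>. s * x + t * y - 1 \<in> \<nn>))"
proof -
  let ?Q = "int_ring Quot \<nn>"
  have sum: "PIdl\<^bsub>?Q\<^esub> (residue \<nn> x) <+>\<^bsub>?Q\<^esub> PIdl\<^bsub>?Q\<^esub> (residue \<nn> y)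
      = {residue \<nn> (s * x + t * y) | s t. s \<in> \<O> \<and> t \<in> \<O>}" if "x \<in> \<O>" "y \<in> \<O>" for x y
  proof -
    have id: "PIdl\<^bsub>?Q\<^esub> (residue \<nn> z) = (\<lambda>s. residue \<nn> (s * z)) ` \<O>" if "z \<in> \<O>" for z
    proof -
      have "PIdl\<^bsub>?Q\<^esub> (residue \<nn> z) = (\<lambda>w. w \<otimes>\<^bsub>?Q\<^esub> residue \<nn> z) ` carrier ?Q"
        by (auto simp: cgenideal_def)
      also have "\<dots> = (\<lambda>s. residue \<nn> s \<otimes>\<^bsub>?Q\<^esub> residue \<nn> z) ` \<O>"
        unfolding carrier_Quot image_image ..
      also have "\<dots> = (\<lambda>s. residue \<nn> (s * z)) ` \<O>"
        using that by (intro image_cong refl residue_arith)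
      finally show ?thesis .
    qed
    have "PIdl\<^bsub>?Q\<^esub> (residue \<nn> x) <+>\<^bsub>?Q\<^esub> PIdl\<^bsub>?Q\<^esub> (residue \<nn> y)
        = (\<Union>s\<in>\<O>. \<Union>t\<in>\<O>. {residue \<nn> (s * x) \<oplus>\<^bsub>?Q\<^esub> residue \<nn> (t * y)})"
      unfolding id[OF that(1)] id[OF that(2)] set_add_def' by (simp only: image_image UN_simps)
    also have "\<dots> = (\<Union>s\<in>\<O>. \<Union>t\<in>\<O>. {residue \<nn> (s * x + t * y)})"
      using that by (intro SUP_cong refl arg_cong[of _ _ "\<lambda>z. {z}"] residue_arith O_closed)
    finally show ?thesis by blast
  qed
  have eq: "{residue \<nn> (s * x + t * y) | s t. s \<in> \<O> \<and> t \<in> \<O>} = residue \<nn> ` \<O>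
      \<longleftrightarrow> (\<exists>s\<in>\<O>. \<exists>t\<in>\<O>. s * x + t * y - 1 \<in> \<nn>)" (is "?L = ?R \<longleftrightarrow> _") if xy: "x \<in> \<O>" "y \<in> \<O>" for x y
  proof
    assume "?L = ?R"
    then have "residue \<nn> 1 \<in> ?L" by (simp only:) (rule imageI, simp)
    then show "\<exists>s\<in>\<O>. \<exists>t\<in>\<O>. s * x + t * y - 1 \<in> \<nn>"
      using residue_eq_iff[of 1] residue_eq_iff[of _ 1] by force
  next
    assume "\<exists>s\<in>\<O>. \<exists>t\<in>\<O>. s * x + t * y - 1 \<in> \<nn>"
    then obtain s t where st: "s \<in> \<O>" "t \<in> \<O>" "s * x + t * y - 1 \<in> \<nn>" by blast
    show "?L = ?R"
    proof
      show "?L \<subseteq> ?R" using xy by auto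
      show "?R \<subseteq> ?L"
      proof clarify
        fix z assume z: "z \<in> \<O>"
        \<comment> \<open>A combination congruent to 1 is scaled by \<open>z\<close> to reach the
          residue of \<open>z\<close>.\<close>
        have "(z * s) * x + (z * t) * y - z = z * (s * x + t * y - 1)" by (simp add: algebra_simps)
        also have "\<dots> \<in> \<nn>" using st(3) z by (rule \<nn>_closed)
        finally have "residue \<nn> z = residue \<nn> ((z * s) * x + (z * t) * y)"
          using residue_eq_iff by metis
        with z st show "\<exists>s t. residue \<nn> z = residue \<nn> (s * x + t * y) \<and> s \<in> \<O> \<and> t \<in> \<O>" by blast
      qed
    qed
  qed
  have "(u, v) \<in> E_set \<nn> \<longleftrightarrow> (\<exists>x\<in>\<O>. \<exists>y\<in>\<O>. u = residue \<nn> x \<and> v = residue \<nn> y \<and>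
     PIdl\<^bsub>?Q\<^esub> (residue \<nn> x) <+>\<^bsub>?Q\<^esub> PIdl\<^bsub>?Q\<^esub> (residue \<nn> y) = carrier ?Q)"
    by (auto simp: E_set_def Let_def carrier_Quot)
  also have "\<dots> \<longleftrightarrow> (\<exists>x\<in>\<O>. \<exists>y\<in>\<O>. u = residue \<nn> x \<and> v = residue \<nn> y \<and>
     (\<exists>s\<in>\<O>. \<exists>t\<in>\<O>. s * x + t * y - 1 \<in> \<nn>))"
    unfolding carrier_Quot by (intro bex_cong refl conj_cong) (simp only: sum eq)
  finally show ?thesis .
qed

section \<open>Integral matrices and their bottom rows\<close>

lemma mat_detD: "(M :: 'k^2^2) \<in> mat_det a \<Longrightarrow> M$i$j \<in> \<O>" "M \<in> mat_det a \<Longrightarrow> det M = a"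
  by (auto simp: mat_det_def)

lemma mat_det_mult: "(A :: 'k^2^2) \<in> mat_det a \<Longrightarrow> B \<in> mat_det b \<Longrightarrow> A ** B \<in> mat_det (a * b)"
  by (auto simp: mat_det_def det_mul mult2_nth)

lemma mat_det_adj2: "(A :: 'k^2^2) \<in> mat_det a \<Longrightarrow> adj2 A \<in> mat_det a"
  by (auto simp: mat_det_def forall_2)

lemma SL2_inverse:
  assumes "(A :: 'k^2^2) \<in> SL2"
  shows "A ** adj2 A = mat 1" "adj2 A ** A = mat 1"
    "A ** (adj2 A ** (B :: 'k^2^2)) = B" "adj2 A ** (A ** B) = B"
  using adj2_inverse[OF mat_detD(2)[OF assms]] by (simp_all add: matrix_mul_assoc matrix_mul_lid)

lemma SL2_mult: "(A :: 'k^2^2) \<in> SL2 \<Longrightarrow> B \<in> mat_det b \<Longrightarrow> A ** B \<in> mat_det b"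
  "(A :: 'k^2^2) \<in> mat_det a \<Longrightarrow> B \<in> SL2 \<Longrightarrow> A ** B \<in> mat_det a"
  using mat_det_mult[of A 1 B b] mat_det_mult[of A a B 1] by simp_all

lemma mat_det_vector:
  "a \<in> \<O> \<Longrightarrow> b \<in> \<O> \<Longrightarrow> c \<in> \<O> \<Longrightarrow> d \<in> \<O> \<Longrightarrow>
    vector [vector [a, b], vector [c, d]] \<in> mat_det (a * d - b * c)"
  by (simp add: mat_det_def forall_2 det_2)

definition same_row :: "'k^2^2 \<Rightarrow> 'k^2^2 \<Rightarrow> bool" where
  "same_row A B \<longleftrightarrow> A$2$1 - B$2$1 \<in> \<nn> \<and> A$2$2 - B$2$2 \<in> \<nn>"

abbreviation row :: "'k^2^2 \<Rightarrow> 'k set \<times> 'k set" where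
  "row h \<equiv> (residue \<nn> (h$2$1), residue \<nn> (h$2$2))"

lemma row_eq_iff: "row A = row B \<longleftrightarrow> same_row A B"
  by (simp add: residue_eq_iff same_row_def)

lemma row_mult_row:
  assumes "A \<in> mat_det a" "M \<in> mat_det b"
  shows "row_mult \<nn> (row A) M = row (A ** M)"
  using mat_detD(1)[OF assms(1)] mat_detD(1)[OF assms(2)]
  by (simp add: row_mult_def Let_def residue_arith mult2_nth mult.commute)

text \<open>
  Write \<open>(x, y) = g (c', d')\<close> with \<open>(c', d')\<close> coprime. Then \<open>g\<close> is a unit modulo \<open>\<nn>\<close>, so \<open>(0, g)\<close>
  lifts to the bottom row of a matrix in \<open>SL2\<close>, to be multiplied by one with bottom row \<open>(c', d')\<close>.
\<close>

lemma E_set_eq_rows: "E_set \<nn> = row ` SL2"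
proof (intro equalityI subsetI)
  fix uv assume "uv \<in> E_set \<nn>"
  then obtain x y s t where xy: "x \<in> \<O>" "y \<in> \<O>" "uv = (residue \<nn> x, residue \<nn> y)"
    and st: "s \<in> \<O>" "t \<in> \<O>" "s * x + t * y - 1 \<in> \<nn>"
    by (cases uv) (auto simp: E_set_iff)
  obtain g c d a b where O: "g \<in> \<O>" "c \<in> \<O>" "d \<in> \<O>" "a \<in> \<O>" "b \<in> \<O>"
    and eq: "x = g * c" "y = g * d" "a * c + b * d = 1"
    by (rule bezout[OF xy(1,2)])
  \<comment> \<open>\<open>e\<close> inverts \<open>g\<close> modulo \<open>\<nn>\<close>, and
    \<open>m\<close> is the error. Since \<open>m\<close> lies in \<open>\<nn>\<close>, the rows
    \<open>(m, g)\<close> and \<open>(0, g)\<close> are congruent, while \<open>?A\<close> has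
    determinant \<open>e * g + m = 1\<close>.\<close>
  define e where "e = s * c + t * d"
  define m where "m = 1 - e * g"
  have e: "e \<in> \<O>" using st O by (simp add: e_def)
  have "m = - (s * x + t * y - 1)" by (simp add: m_def e_def eq algebra_simps)
  then have m: "m \<in> \<nn>" using \<nn>_uminus[OF st(3)] by simp
  let ?A = "vector [vector [e, - 1], vector [m, g]] :: 'k^2^2"
  let ?B = "vector [vector [b, - a], vector [c, d]] :: 'k^2^2"
  have A: "?A \<in> SL2" using mat_det_vector[of e "- 1" m g] e O \<nn>_closed(5)[OF m] by (simp add: m_def)
  have B: "?B \<in> SL2" using mat_det_vector[of b "- a" c d] O eq(3) by (simp add: add.commute)
  have "uv = row (?A ** ?B)"
    using \<nn>_closed(4)[OF m, of b] \<nn>_closed(4)[OF m, of a] O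
    by (simp add: xy(3) residue_eq_iff mult2_nth eq \<nn>_uminus)
  with SL2_mult(1)[OF A B] show "uv \<in> row ` SL2" by blast
next
  fix uv assume "uv \<in> row ` SL2"
  then obtain h where h: "h \<in> SL2" "uv = row h" by blast
  \<comment> \<open>The determinant is itself the Bezout identity for the bottom row.\<close>
  have "- h$1$2 * h$2$1 + h$1$1 * h$2$2 - 1 = 0"
    using mat_detD(2)[OF h(1)] by (simp add: det_2)
  then show "uv \<in> E_set \<nn>"
    using mat_detD(1)[OF h(1)] \<nn>_closed(1) unfolding h(2) E_set_iff
    by (intro bexI[of _ "h$2$1"] bexI[of _ "h$2$2"] conjI refl bexI[of _ "- h$1$2"] bexI[of _ "h$1$1"]) auto
qed

section \<open>The group \<open>Gamma1 \<nn>\<close> and its action on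
  \<open>Delta \<nn> \<eta>\<close>\<close>

lemma Gamma1_SL2: "\<gamma> \<in> Gamma1 \<nn> \<Longrightarrow> \<gamma> \<in> SL2"
  by (simp add: Gamma1_def)

text \<open>The bottom row of \<open>A ** adj2 B\<close> differs from that of
  \<open>B ** adj2 B\<close>, the identity, by the difference of the rows of \<open>A\<close> and
  \<open>B\<close> times \<open>adj2 B\<close>, which vanishes modulo \<open>\<nn>\<close>. So a
  bottom row modulo \<open>\<nn>\<close> determines the coset of a matrix in
  \<open>SL2\<close>.\<close>

lemma Gamma1I:
  assumes "A \<in> SL2" "B \<in> SL2" "same_row A B"
  shows "A ** adj2 B \<in> Gamma1 \<nn>"
proof -
  note O = mat_detD(1)[OF assms(1)] mat_detD(1)[OF assms(2)]
  have d: "B$1$1 * B$2$2 - B$1$2 * B$2$1 = 1" using mat_detD(2)[OF assms(2)] by (simp add: det_2)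
  have r: "A$2$1 - B$2$1 \<in> \<nn>" "A$2$2 - B$2$2 \<in> \<nn>" using assms(3) by (auto simp: same_row_def)
  have "(A ** adj2 B)$2$1 = (A$2$1 - B$2$1) * B$2$2 - (A$2$2 - B$2$2) * B$2$1"
    by (simp add: mult2_nth algebra_simps)
  moreover have "(A ** adj2 B)$2$2 - 1 = (A$2$2 - B$2$2) * B$1$1 - (A$2$1 - B$2$1) * B$1$2"
    unfolding d[symmetric] by (simp add: mult2_nth algebra_simps)
  ultimately show ?thesis
    using SL2_mult(1)[OF assms(1) mat_det_adj2[OF assms(2)]] r O
    by (simp add: Gamma1_def \<nn>_diff \<nn>_closed)
qed

lemma Gamma1_one: "mat 1 \<in> Gamma1 \<nn>"
  by (simp add: Gamma1_def mat_det_def forall_2 \<nn>_closed mat_def det_2)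

lemma Gamma1_same_row:
  assumes "\<gamma> \<in> Gamma1 \<nn>" "A \<in> mat_det a"
  shows "same_row (\<gamma> ** A) A"
proof -
  note O = mat_detD(1)[OF assms(2)]
  have r: "\<gamma>$2$1 \<in> \<nn>" "\<gamma>$2$2 - 1 \<in> \<nn>" using assms(1) by (auto simp: Gamma1_def)
  have "(\<gamma> ** A)$2$j - A$2$j = \<gamma>$2$1 * A$1$j + (\<gamma>$2$2 - 1) * A$2$j" for j
    by (simp add: mult2_nth algebra_simps)
  then show ?thesis using r O by (simp add: same_row_def \<nn>_closed)
qed

lemma Gamma1_mult: "A \<in> Gamma1 \<nn> \<Longrightarrow> B \<in> Gamma1 \<nn> \<Longrightarrow> A ** B \<in> Gamma1 \<nn>"
  using Gamma1_same_row[of A B 1] SL2_mult(1)[of A B 1] \<nn>_closed(2)[of "(A ** B)$2$1 - B$2$1" "B$2$1"]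
    \<nn>_closed(2)[of "(A ** B)$2$2 - B$2$2" "B$2$2 - 1"]
  by (simp add: Gamma1_def same_row_def)

lemma Gamma1_adj2:
  assumes "A \<in> Gamma1 \<nn>"
  shows "adj2 A \<in> Gamma1 \<nn>"
proof -
  have "- A$2$1 \<in> \<nn>" "1 - A$2$2 \<in> \<nn>"
    using assms \<nn>_uminus[of "A$2$1"] \<nn>_uminus[of "A$2$2 - 1"] by (simp_all add: Gamma1_def)
  then have "same_row (mat 1) A"
    by (simp add: same_row_def mat_def)
  from Gamma1I[OF Gamma1_SL2[OF Gamma1_one] Gamma1_SL2[OF assms] this] show ?thesis
    by (simp add: matrix_mul_lid)
qed

text \<open>The upper left entry of a matrix is the lower right entry of its adjugate.\<close>

lemma Gamma1_1_1: assumes "\<gamma> \<in> Gamma1 \<nn>" shows "\<gamma>$1$1 - 1 \<in> \<nn>"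
  using Gamma1_adj2[OF assms] by (simp add: Gamma1_def)

lemma Delta_mat_det: "\<delta> \<in> Delta \<nn> \<eta> \<Longrightarrow> \<delta> \<in> mat_det \<eta>"
  by (simp add: Delta_def)

text \<open>Modulo \<open>\<nn>\<close> the elements of both sets have first column
  \<open>(1, 0)\<close>, and this property is stable under products.\<close>

lemma Gamma1_Delta:
  assumes "\<gamma> \<in> Gamma1 \<nn>" "\<delta> \<in> Delta \<nn> \<eta>"
  shows "\<gamma> ** \<delta> \<in> Delta \<nn> \<eta>" "\<delta> ** \<gamma> \<in> Delta \<nn> \<eta>"
proof -
  note O = mat_detD(1)[OF Gamma1_SL2[OF assms(1)]] mat_detD(1)[OF Delta_mat_det[OF assms(2)]]
  have \<gamma>: "\<gamma>$2$1 \<in> \<nn>" "\<gamma>$2$2 - 1 \<in> \<nn>" "\<gamma>$1$1 - 1 \<in> \<nn>"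
    using assms(1) Gamma1_1_1 by (auto simp: Gamma1_def)
  have \<delta>: "\<delta>$2$1 \<in> \<nn>" "\<delta>$1$1 - 1 \<in> \<nn>" using assms(2) by (auto simp: Delta_def)
  have "(\<gamma> ** \<delta>)$1$1 - 1 = (\<gamma>$1$1 - 1) * \<delta>$1$1 + ((\<delta>$1$1 - 1) + \<gamma>$1$2 * \<delta>$2$1)"
    "(\<delta> ** \<gamma>)$1$1 - 1 = (\<delta>$1$1 - 1) * \<gamma>$1$1 + ((\<gamma>$1$1 - 1) + \<delta>$1$2 * \<gamma>$2$1)"
    by (simp_all add: mult2_nth algebra_simps)
  then have "(\<gamma> ** \<delta>)$1$1 - 1 \<in> \<nn>" "(\<delta> ** \<gamma>)$1$1 - 1 \<in> \<nn>"
    by (simp_all only: \<nn>_closed O \<gamma> \<delta>)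
  moreover have "(\<gamma> ** \<delta>)$2$1 \<in> \<nn>" "(\<delta> ** \<gamma>)$2$1 \<in> \<nn>"
    using O \<gamma> \<delta> by (simp_all add: mult2_nth \<nn>_closed)
  ultimately show "\<gamma> ** \<delta> \<in> Delta \<nn> \<eta>" "\<delta> ** \<gamma> \<in> Delta \<nn> \<eta>"
    using SL2_mult(1)[OF Gamma1_SL2[OF assms(1)] Delta_mat_det[OF assms(2)]]
      SL2_mult(2)[OF Delta_mat_det[OF assms(2)] Gamma1_SL2[OF assms(1)]]
    by (simp_all add: Delta_def)
qed

text \<open>Slashing with \<open>g\<close> substitutes the linear forms given by
  \<open>adj2 g\<close>. Since adjugates reverse products, composition comes out as a left
  action.\<close>

lemma poly_slash_mult:
  assumes "g \<in> mat_det a" "h \<in> mat_det b"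
  shows "poly_slash \<rho> h (poly_slash \<rho> g P) = poly_slash \<rho> (h ** g) P"
proof -
  note O = mat_detD(1)[OF assms(1)] mat_detD(1)[OF assms(2)]
  have "const2 (\<rho> x) * lin_form \<rho> a b + const2 (\<rho> y) * lin_form \<rho> c d
      = lin_form \<rho> (x * a + y * c) (x * b + y * d)"
    if "x \<in> \<O>" "y \<in> \<O>" "a \<in> \<O>" "b \<in> \<O>" "c \<in> \<O>" "d \<in> \<O>" for x y a b c d
    using that by (simp add: lin_form_def \<rho>_simps algebra_simps)
  then have "subst2 (lin_form \<rho> x y) (lin_form \<rho> a b) (lin_form \<rho> c d)
      = lin_form \<rho> (x * a + y * c) (x * b + y * d)"
    if "x \<in> \<O>" "y \<in> \<O>" "a \<in> \<O>" "b \<in> \<O>" "c \<in> \<O>" "d \<in> \<O>" for x y a b c d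
    using that by simp
  then show ?thesis
    unfolding poly_slash_def subst2_subst2 using O
    by (simp add: mult2_nth algebra_simps del: subst2_lin_form)
qed

lemma symbol_slash_mult:
  assumes "g \<in> mat_det a" "h \<in> mat_det b" "a \<noteq> 0" and "x \<in> carrier (pre_symbols n)"
  shows "symbol_slash \<rho> h (symbol_slash \<rho> g x) = symbol_slash \<rho> (h ** g) x"
  using assms(4)
proof (induction x rule: pre_symbol_induct)
  case (symb P \<alpha> \<beta>)
  show ?case
    using mat_detD(2)[OF assms(1)] \<open>a \<noteq> 0\<close>
    by (simp add: symbol_slash_symb poly_slash_mult[OF assms(1,2)] moebius_mult)
qed (simp_all add: symbol_slash_add)

end

section \<open>The Hecke operator on Manin symbols\<close>

text \<open>
  Modulo the three-term relation, \<open>P \<otimes> {f \<beta>, f \<alpha>}\<close> is the difference of the images of \<open>\<alpha>\<close> and \<open>\<beta>\<close>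
  under this linear map, whatever the base point \<open>z\<close>.
\<close>

definition point_symbols ::
  "'r::comm_ring_1 poly poly \<Rightarrow> 'k P1 \<Rightarrow> ('a \<Rightarrow> 'k P1) \<Rightarrow> ('a \<Rightarrow>\<^sub>0 'r) \<Rightarrow> ('k, 'r) pre_symbol" where
  "point_symbols P z f x =
     (\<Sum>\<alpha>\<in>Poly_Mapping.keys x. symb (const2 (Poly_Mapping.lookup x \<alpha>) * P) z (f \<alpha>))"

lemma point_symbols_superset:
  assumes "finite S" "Poly_Mapping.keys x \<subseteq> S"
  shows "point_symbols P z f x = (\<Sum>\<alpha>\<in>S. symb (const2 (Poly_Mapping.lookup x \<alpha>) * P) z (f \<alpha>))"
  unfolding point_symbols_def
  using assms by (intro sum.mono_neutral_left) (auto simp: in_keys_iff)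

lemma point_symbols_0 [simp]: "point_symbols P z f 0 = 0"
  by (simp add: point_symbols_def)

lemma point_symbols_add:
  "point_symbols P z f (x + y) = point_symbols P z f x + point_symbols P z f y"
proof -
  let ?S = "Poly_Mapping.keys x \<union> Poly_Mapping.keys y"
  show ?thesis
    by (simp add: point_symbols_superset[of ?S] Poly_Mapping.keys_add lookup_add symb_add distrib_right sum.distrib)
qed

lemma point_symbols_diff:
  "point_symbols P z f (x - y) = point_symbols P z f x - point_symbols P z f y"
  using point_symbols_add[of P z f "x - y" y] by simp

lemma point_symbols_sum:
  "point_symbols P z f (sum g I) = (\<Sum>i\<in>I. point_symbols P z f (g i))"
  by (induction I rule: infinite_finite_induct) (simp_all add: point_symbols_add)

lemma point_symbols_single:
  "point_symbols P z f (Poly_Mapping.single \<alpha> r) = symb (const2 r * P) z (f \<alpha>)"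
  by (subst point_symbols_superset[of "{\<alpha>}"]) (auto simp: lookup_single)

lemma symb_diff_rel:
  assumes "P \<in> hom_polys (k - 2)"
  shows "symb P \<beta> \<alpha> - (symb P z \<alpha> - symb P z \<beta>) \<in> symbol_relations \<rho> k \<Gamma>"
proof -
  \<comment> \<open>The triangle on \<open>z\<close>, \<open>\<beta>\<close>,
    \<open>\<alpha>\<close>, minus the degenerate triangle on \<open>z\<close>,
    \<open>\<alpha>\<close>, \<open>z\<close>, which together with the trivial symbol at
    \<open>z\<close> encodes antisymmetry.\<close>
  have "(symb P z \<beta> + symb P \<beta> \<alpha> + symb P \<alpha> z) - (symb P z \<alpha> + symb P \<alpha> z + symb P z z) + symb P z z
    \<in> symbol_relations \<rho> k \<Gamma>"
    using assms by (intro symbol_relations_add symbol_relations_diff symbol_relations_gens)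
  then show ?thesis by (simp add: algebra_simps)
qed

text \<open>Applying \<open>point_symbols\<close> with base point \<open>f b0\<close> to the
  identity of divisors gives an identity between differences of symbols that start there;
  \<open>symb_diff_rel\<close> replaces each difference by a single symbol.\<close>

lemma symb_sum_rel:
  assumes P: "P \<in> hom_polys (k - 2)"
    and eq: "(\<Sum>i\<in>I. Poly_Mapping.single (a i) (r i) - Poly_Mapping.single (b i) (r i))
      = Poly_Mapping.single a0 1 - Poly_Mapping.single b0 1"
  shows "symb P (f b0) (f a0) - (\<Sum>i\<in>I. symb (const2 (r i) * P) (f (b i)) (f (a i)))
    \<in> symbol_relations \<rho> k \<Gamma>"
proof -
  let ?z = "f b0"
  let ?d = "\<lambda>r \<alpha> \<beta>. symb (const2 r * P) ?z \<alpha> - symb (const2 r * P) ?z \<beta>"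
  have "(\<Sum>i\<in>I. ?d (r i) (f (a i)) (f (b i))) = ?d 1 (f a0) (f b0)"
    using arg_cong[OF eq, of "point_symbols P ?z f"]
    by (simp add: point_symbols_sum point_symbols_diff point_symbols_single)
  then have "symb P (f b0) (f a0) - (\<Sum>i\<in>I. symb (const2 (r i) * P) (f (b i)) (f (a i)))
     = (symb P (f b0) (f a0) - (symb P ?z (f a0) - symb P ?z (f b0)))
       - (\<Sum>i\<in>I. symb (const2 (r i) * P) (f (b i)) (f (a i)) - ?d (r i) (f (a i)) (f (b i)))"
    unfolding sum_subtractf[of _ "\<lambda>i. ?d (r i) (f (a i)) (f (b i))"] by simp
  also have "\<dots> \<in> symbol_relations \<rho> k \<Gamma>"
    using P by (intro symbol_relations_diff symbol_relations_sum symb_diff_rel hom_polys_const2_mult)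
  finally show ?thesis .
qed

section \<open>Descent of the Hecke operator to classes\<close>

context modular_setting
begin

abbreviation coset :: "'k^2^2 \<Rightarrow> ('k^2^2) set" where
  "coset \<delta> \<equiv> (\<lambda>\<gamma>. \<gamma> ** \<delta>) ` Gamma1 \<nn>"

abbreviation rep :: "('k^2^2) set \<Rightarrow> 'k^2^2" where
  "rep D \<equiv> SOME \<delta>. \<delta> \<in> D"

lemma coset_self: "\<delta> \<in> coset \<delta>"
  using Gamma1_one by (metis imageI matrix_mul_lid)

lemma coset_eq:
  assumes "\<gamma> \<in> Gamma1 \<nn>"
  shows "coset (\<gamma> ** \<delta>) = coset \<delta>"
proof (intro equalityI subsetI)
  fix x assume "x \<in> coset (\<gamma> ** \<delta>)"
  then obtain \<gamma>' where "\<gamma>' \<in> Gamma1 \<nn>" "x = (\<gamma>' ** \<gamma>) ** \<delta>" by (auto simp: matrix_mul_assoc)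
  then show "x \<in> coset \<delta>" using Gamma1_mult[OF _ assms] by blast
next
  fix x assume "x \<in> coset \<delta>"
  then obtain \<gamma>' where \<gamma>': "\<gamma>' \<in> Gamma1 \<nn>" "x = \<gamma>' ** \<delta>" by blast
  then have "x = (\<gamma>' ** adj2 \<gamma>) ** (\<gamma> ** \<delta>)"
    using SL2_inverse[OF Gamma1_SL2[OF assms]] by (simp flip: matrix_mul_assoc)
  then show "x \<in> coset (\<gamma> ** \<delta>)" using Gamma1_mult[OF \<gamma>'(1) Gamma1_adj2[OF assms]] by blast
qed

lemma rep_coset:
  assumes "D \<in> left_quotient (Gamma1 \<nn>) (Delta \<nn> \<eta>)"
  shows "rep D \<in> Delta \<nn> \<eta>" "coset (rep D) = D"
proof -
  obtain \<delta> where \<delta>: "\<delta> \<in> Delta \<nn> \<eta>" "D = coset \<delta>" using assms by (auto simp: left_quotient_def)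
  have "rep D \<in> D" using coset_self \<delta>(2) by (metis someI)
  then obtain \<gamma> where \<gamma>: "\<gamma> \<in> Gamma1 \<nn>" "rep D = \<gamma> ** \<delta>" using \<delta>(2) by blast
  show "rep D \<in> Delta \<nn> \<eta>" using Gamma1_Delta(1)[OF \<gamma>(1) \<delta>(1)] \<gamma>(2) by simp
  show "coset (rep D) = D" using coset_eq[OF \<gamma>(1)] \<gamma>(2) \<delta>(2) by simp
qed

text \<open>Two elements of one coset differ on the left by some \<open>\<gamma>\<close> in
  \<open>Gamma1 \<nn>\<close>, and slashing with \<open>\<gamma>\<close> is trivial modulo the
  relations. Hence the choice of representatives in \<open>hecke_pre\<close> does not affect
  classes.\<close>

lemma symbol_slash_coset:
  assumes "coset \<delta>' = coset \<delta>" "\<delta> \<in> mat_det \<eta>" "\<eta> \<noteq> 0" and x: "x \<in> carrier (pre_symbols (k - 2))"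
  shows "symbol_slash \<rho> \<delta>' x - symbol_slash \<rho> \<delta> x \<in> symbol_relations \<rho> k (Gamma1 \<nn>)"
proof -
  obtain \<gamma> where \<gamma>: "\<gamma> \<in> Gamma1 \<nn>" "\<delta>' = \<gamma> ** \<delta>"
    using coset_self[of \<delta>'] assms(1) by auto
  have "symbol_slash \<rho> \<gamma> (symbol_slash \<rho> \<delta> x) - symbol_slash \<rho> \<delta> x \<in> symbol_relations \<rho> k (Gamma1 \<nn>)"
    by (intro symbol_relations_gens symbol_slash_carrier \<gamma> x)
  then show ?thesis
    using symbol_slash_mult[OF assms(2) Gamma1_SL2[OF \<gamma>(1)] assms(3) x] \<gamma>(2) by simp
qed

lemma hecke_pre_0: "hecke_pre \<rho> \<nn> \<eta> 0 = 0"
  by (simp add: hecke_pre_def)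

lemma hecke_pre_add: "hecke_pre \<rho> \<nn> \<eta> (x + y) = hecke_pre \<rho> \<nn> \<eta> x + hecke_pre \<rho> \<nn> \<eta> y"
  by (simp add: hecke_pre_def symbol_slash_add sum.distrib)

lemma hecke_pre_uminus: "hecke_pre \<rho> \<nn> \<eta> (- x) = - hecke_pre \<rho> \<nn> \<eta> x"
  by (simp add: hecke_pre_def symbol_slash_uminus sum_negf)

lemma hecke_pre_diff: "hecke_pre \<rho> \<nn> \<eta> (x - y) = hecke_pre \<rho> \<nn> \<eta> x - hecke_pre \<rho> \<nn> \<eta> y"
  using hecke_pre_add[of \<eta> x "- y"] by (simp add: hecke_pre_uminus)

text \<open>Right multiplication by \<open>\<gamma>\<close> permutes the cosets in \<open>Delta\<close>.\<close>

lemma hecke_pre_slash: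
  assumes \<eta>: "\<eta> \<noteq> 0" and \<gamma>: "\<gamma> \<in> Gamma1 \<nn>" and x: "x \<in> carrier (pre_symbols (k - 2))"
  shows "hecke_pre \<rho> \<nn> \<eta> (symbol_slash \<rho> \<gamma> x) - hecke_pre \<rho> \<nn> \<eta> x \<in> symbol_relations \<rho> k (Gamma1 \<nn>)"
proof -
  let ?L = "left_quotient (Gamma1 \<nn>) (Delta \<nn> \<eta>)"
  let ?f = "\<lambda>\<gamma> D. (\<lambda>A. A ** \<gamma>) ` D"
  have f: "?f \<gamma> (coset \<delta>) = coset (\<delta> ** \<gamma>)" for \<gamma> \<delta>
    by (simp add: image_image matrix_mul_assoc)
  have in_L: "?f \<gamma> D \<in> ?L" if \<gamma>: "\<gamma> \<in> Gamma1 \<nn>" and D: "D \<in> ?L" for \<gamma> D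
  proof -
    obtain \<delta> where \<delta>: "\<delta> \<in> Delta \<nn> \<eta>" "D = coset \<delta>" using D by (auto simp: left_quotient_def)
    show ?thesis
      unfolding left_quotient_def \<delta>(2) f using Gamma1_Delta(2)[OF \<gamma> \<delta>(1)] by (rule imageI)
  qed
  have inv: "?f (adj2 \<gamma>) (?f \<gamma> D) = D" "?f \<gamma> (?f (adj2 \<gamma>) D) = D" for D
    using SL2_inverse[OF Gamma1_SL2[OF \<gamma>]]
    by (simp_all add: image_image matrix_mul_rid flip: matrix_mul_assoc)
  have bij: "bij_betw (?f \<gamma>) ?L ?L"
    by (rule bij_betwI[where g = "?f (adj2 \<gamma>)"])
      (assumption | rule inv funcsetI in_L[OF \<gamma>] in_L[OF Gamma1_adj2[OF \<gamma>]])+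
  \<comment> \<open>Finiteness of the set of cosets is not known here; over an infinite set the sums
    are 0 and the reindexing still holds.\<close>
  have "hecke_pre \<rho> \<nn> \<eta> x = (\<Sum>D\<in>?L. symbol_slash \<rho> (rep (?f \<gamma> D)) x)"
    unfolding hecke_pre_def by (rule sum.reindex_bij_betw[OF bij, symmetric])
  then have "hecke_pre \<rho> \<nn> \<eta> (symbol_slash \<rho> \<gamma> x) - hecke_pre \<rho> \<nn> \<eta> x
      = (\<Sum>D\<in>?L. symbol_slash \<rho> (rep D) (symbol_slash \<rho> \<gamma> x) - symbol_slash \<rho> (rep (?f \<gamma> D)) x)"
    by (simp add: hecke_pre_def sum_subtractf)
  also have "\<dots> \<in> symbol_relations \<rho> k (Gamma1 \<nn>)"
  proof (intro symbol_relations_sum)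
    fix D assume D: "D \<in> ?L"
    note rep = rep_coset[OF D] and rep' = rep_coset[OF in_L[OF \<gamma> D]]
    \<comment> \<open>The chosen representative of the translated coset may differ from the
      translate of the chosen one, but both lie in the same coset.\<close>
    have "coset (rep D ** \<gamma>) = coset (rep (?f \<gamma> D))"
      using f[of \<gamma> "rep D"] rep(2) rep'(2) by simp
    from symbol_slash_coset[OF this Delta_mat_det[OF rep'(1)] \<eta> x]
    show "symbol_slash \<rho> (rep D) (symbol_slash \<rho> \<gamma> x) - symbol_slash \<rho> (rep (?f \<gamma> D)) x
      \<in> symbol_relations \<rho> k (Gamma1 \<nn>)"
      using symbol_slash_mult[OF Gamma1_SL2[OF \<gamma>] Delta_mat_det[OF rep(1)] _ x] by simp
  qed
  finally show ?thesis .
qed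

text \<open>Slashing maps trivial symbols and triangles to symbols of the same form; the relations
  from \<open>Gamma1 \<nn>\<close> are covered by \<open>hecke_pre_slash\<close>.\<close>

lemma hecke_pre_rel:
  assumes \<eta>: "\<eta> \<noteq> 0" and "x \<in> symbol_relations \<rho> k (Gamma1 \<nn>)"
  shows "hecke_pre \<rho> \<nn> \<eta> x \<in> symbol_relations \<rho> k (Gamma1 \<nn>)"
  using assms(2)
proof (induction rule: symbol_relations_induct)
  case (symb P \<alpha>)
  then show ?case
    unfolding hecke_pre_def symbol_slash_symb
    by (intro symbol_relations_sum symbol_relations_gens poly_slash_hom_polys)
next
  case (triangle P \<alpha> \<beta> \<gamma>)
  then show ?case
    unfolding hecke_pre_def symbol_slash_add symbol_slash_symb
    by (intro symbol_relations_sum symbol_relations_gens poly_slash_hom_polys)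
next
  case (slash g x)
  then show ?case
    unfolding hecke_pre_diff using \<eta> by (intro hecke_pre_slash)
qed (auto simp: hecke_pre_0 hecke_pre_add hecke_pre_uminus
    intro: symbol_relations_0 symbol_relations_add symbol_relations_uminus)

lemma hecke_symbol_class:
  assumes "\<eta> \<noteq> 0"
  shows "hecke \<rho> k \<nn> \<eta> (symbol_class \<rho> k (Gamma1 \<nn>) x) = symbol_class \<rho> k (Gamma1 \<nn>) (hecke_pre \<rho> \<nn> \<eta> x)"
proof -
  have "hecke \<rho> k \<nn> \<eta> (symbol_class \<rho> k (Gamma1 \<nn>) x)
     = (\<Union>y\<in>symbol_class \<rho> k (Gamma1 \<nn>) x. symbol_class \<rho> k (Gamma1 \<nn>) (hecke_pre \<rho> \<nn> \<eta> x))"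
    unfolding hecke_def
    by (intro SUP_cong refl)
      (simp add: symbol_class_eq_iff mem_symbol_class hecke_pre_rel[OF assms] flip: hecke_pre_diff)
  also have "\<dots> = symbol_class \<rho> k (Gamma1 \<nn>) (hecke_pre \<rho> \<nn> \<eta> x)"
    using mem_symbol_class[of x \<rho> k "Gamma1 \<nn>" x] symbol_relations_0 by auto
  finally show ?thesis .
qed

definition row_lift :: "'k set \<times> 'k set \<Rightarrow> 'k^2^2" where
  "row_lift uv = (SOME h. h \<in> SL2 \<and> row h = uv)"

lemma row_lift:
  assumes "uv \<in> E_set \<nn>"
  shows "row_lift uv \<in> SL2" "row (row_lift uv) = uv"
proof -
  have "\<exists>h. h \<in> SL2 \<and> row h = uv" using assms unfolding E_set_eq_rows by blast
  then have "row_lift uv \<in> SL2 \<and> row (row_lift uv) = uv" unfolding row_lift_def by (rule someI_ex)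
  then show "row_lift uv \<in> SL2" "row (row_lift uv) = uv" by blast+
qed

definition manin_pre :: "'r poly poly \<Rightarrow> 'k^2^2 \<Rightarrow> ('k, 'r) pre_symbol" where
  "manin_pre P h = symb (poly_slash \<rho> h P) (moebius h P1_zero) (moebius h P1_inf)"

lemma manin_symbol_row_eq:
  "manin_symbol_row \<rho> k \<nn> P uv = symbol_class \<rho> k (Gamma1 \<nn>) (manin_pre P (row_lift uv))"
  by (simp only: manin_symbol_row_def manin_symbol_def manin_pre_def row_lift_def)

lemma manin_pre_carrier: "P \<in> hom_polys n \<Longrightarrow> manin_pre P h \<in> carrier (pre_symbols n)"
  unfolding manin_pre_def by (intro symb_carrier poly_slash_hom_polys)

end

section \<open>Sorting the matrices \<open>M\<close> by the cosets in
  \<open>Delta \<nn> \<eta>\<close>\<close>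

locale hecke_setting = modular_setting \<rho> \<nn>
  for \<rho> :: "'k::field_char_0 \<Rightarrow> 'r::comm_ring_1" and \<nn> :: "'k set" +
  fixes \<eta> :: 'k and k :: nat and P :: "'r poly poly" and uv :: "'k set \<times> 'k set"
    and c :: "'k^2^2 \<Rightarrow>\<^sub>0 'r"
  assumes \<eta>: "\<eta> \<noteq> 0" and P: "P \<in> hom_polys (k - 2)" and uv: "uv \<in> E_set \<nn>"
    and keys_c: "Poly_Mapping.keys c \<subseteq> mat_det \<eta>"
    and c_sum: "\<forall>C \<in> right_quotient (mat_det \<eta>) SL2.
           (\<Sum>M \<in> C \<inter> Poly_Mapping.keys c.
              Poly_Mapping.single (moebius M P1_inf) (Poly_Mapping.lookup c M)
              - Poly_Mapping.single (moebius M P1_zero) (Poly_Mapping.lookup c M))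
           = Poly_Mapping.single P1_inf 1 - Poly_Mapping.single P1_zero 1"
begin

definition h :: "'k^2^2" where "h = row_lift uv"

definition S :: "('k^2^2) set" where
  "S = {M \<in> Poly_Mapping.keys c. row_mult \<nn> uv M \<in> E_set \<nn>}"

definition lift :: "'k^2^2 \<Rightarrow> 'k^2^2" where
  "lift M = row_lift (row_mult \<nn> uv M)"

abbreviation "\<Gamma> \<equiv> Gamma1 \<nn>"
abbreviation "L \<equiv> left_quotient \<Gamma> (Delta \<nn> \<eta>)"

text \<open>This is the product of \<open>lift M\<close>, \<open>adj2 M\<close> and the inverse of
  \<open>h\<close>, in this order. Another choice of \<open>lift M\<close> would multiply it on the
  left by an element of \<open>\<Gamma>\<close>, which leaves its coset unchanged.\<close>

definition to_delta :: "'k^2^2 \<Rightarrow> 'k^2^2" where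
  "to_delta M = lift M ** adj2 (h ** M)"

lemma h_SL2: "h \<in> SL2" and row_h: "row h = uv"
  unfolding h_def using row_lift[OF uv] by auto

lemma row_mult_uv: "M \<in> mat_det a \<Longrightarrow> row_mult \<nn> uv M = row (h ** M)"
  using row_mult_row[OF h_SL2] row_h by metis

lemma S_D:
  assumes "M \<in> S"
  shows "M \<in> Poly_Mapping.keys c" "M \<in> mat_det \<eta>" "lift M \<in> SL2" "same_row (lift M) (h ** M)"
proof -
  show M: "M \<in> Poly_Mapping.keys c" "M \<in> mat_det \<eta>" using assms keys_c by (auto simp: S_def)
  have "row_mult \<nn> uv M \<in> E_set \<nn>" using assms by (simp add: S_def)
  from row_lift[OF this] show "lift M \<in> SL2" "same_row (lift M) (h ** M)"
    unfolding lift_def by (simp_all only: row_mult_uv[OF M(2)] flip: row_eq_iff)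
qed

text \<open>With \<open>K = h ** M\<close>, the first column of \<open>adj2 K\<close> involves only
  the bottom row of \<open>K\<close>, which is congruent to that of \<open>lift M\<close>. So modulo
  \<open>\<nn>\<close> the first column of the product is that of
  \<open>lift M ** adj2 (lift M)\<close>, the identity.\<close>

lemma to_delta_Delta:
  assumes "M \<in> S"
  shows "to_delta M \<in> Delta \<nn> \<eta>"
proof -
  note M = S_D[OF assms]
  define K where "K = h ** M"
  let ?g = "lift M"
  have K: "K \<in> mat_det \<eta>" unfolding K_def using SL2_mult(1)[OF h_SL2 M(2)] .
  note O = mat_detD(1)[OF K] mat_detD(1)[OF M(3)]
  have r: "?g$2$1 - K$2$1 \<in> \<nn>" "?g$2$2 - K$2$2 \<in> \<nn>"
    using M(4) by (simp_all add: same_row_def K_def)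
  have d: "?g$1$1 * ?g$2$2 - ?g$1$2 * ?g$2$1 = 1"
    using mat_detD(2)[OF M(3)] by (simp add: det_2)
  have "(?g ** adj2 K)$2$1 = (?g$2$1 - K$2$1) * K$2$2 - (?g$2$2 - K$2$2) * K$2$1"
    by (simp add: mult2_nth algebra_simps)
  moreover have "(?g ** adj2 K)$1$1 - 1 = (?g$2$1 - K$2$1) * ?g$1$2 - (?g$2$2 - K$2$2) * ?g$1$1"
    unfolding d[symmetric] by (simp add: mult2_nth algebra_simps)
  ultimately show ?thesis
    using SL2_mult(1)[OF M(3) mat_det_adj2[OF K]] r O
    unfolding to_delta_def K_def[symmetric] by (simp add: Delta_def \<nn>_diff \<nn>_closed)
qed

text \<open>Solving \<open>to_delta M = \<gamma> ** rep D\<close> for \<open>M\<close> puts it into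
  the class of \<open>adj2 h ** adj2 (rep D)\<close>. Conversely, for a matrix of that class the row
  \<open>row_mult \<nn> uv M\<close> is the bottom row of some \<open>g\<close> in
  \<open>SL2\<close>, so \<open>M\<close> belongs to \<open>S\<close> and its lift is
  \<open>g\<close> up to \<open>\<Gamma>\<close>.\<close>

lemma fibre:
  assumes D: "D \<in> L"
  shows "{M \<in> S. coset (to_delta M) = D}
    = (\<lambda>g. (adj2 h ** adj2 (rep D)) ** g) ` SL2 \<inter> Poly_Mapping.keys c" (is "?A = ?B")
proof (intro equalityI subsetI)
  let ?\<delta> = "rep D"
  note \<delta> = rep_coset[OF D]
  fix M assume "M \<in> ?A"
  then have M: "M \<in> S" and eq: "coset (to_delta M) = D" by auto
  obtain \<gamma> where \<gamma>: "\<gamma> \<in> \<Gamma>" "lift M ** adj2 (h ** M) = \<gamma> ** ?\<delta>"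
    using coset_self[of "to_delta M"] eq \<delta>(2) unfolding to_delta_def by blast
  \<comment> \<open>Adjugates reverse the products, which brings \<open>h ** M\<close> to the front
    and leaves \<open>adj2 (lift M)\<close> at the end, where it cancels.\<close>
  have "(h ** M) ** adj2 (lift M) = adj2 ?\<delta> ** adj2 \<gamma>"
    using arg_cong[OF \<gamma>(2), of adj2] by (simp only: adj2_mult adj2_adj2)
  then have "((h ** M) ** adj2 (lift M)) ** lift M = (adj2 ?\<delta> ** adj2 \<gamma>) ** lift M" by simp
  then have "h ** M = adj2 ?\<delta> ** (adj2 \<gamma> ** lift M)"
    using SL2_inverse[OF S_D(3)[OF M]] by (simp add: matrix_mul_rid flip: matrix_mul_assoc)
  then have "M = adj2 h ** (adj2 ?\<delta> ** (adj2 \<gamma> ** lift M))"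
    using SL2_inverse[OF h_SL2] by metis
  then have "M = (adj2 h ** adj2 ?\<delta>) ** (adj2 \<gamma> ** lift M)"
    by (simp add: matrix_mul_assoc)
  moreover have "adj2 \<gamma> ** lift M \<in> SL2"
    using SL2_mult(1)[OF mat_det_adj2[OF Gamma1_SL2[OF \<gamma>(1)]] S_D(3)[OF M]] .
  ultimately show "M \<in> ?B" using S_D(1)[OF M] by blast
next
  let ?\<delta> = "rep D"
  note \<delta> = rep_coset[OF D]
  fix M assume "M \<in> ?B"
  then obtain g where g: "g \<in> SL2" "M = (adj2 h ** adj2 ?\<delta>) ** g" and M: "M \<in> Poly_Mapping.keys c" by blast
  have hM: "h ** M = adj2 ?\<delta> ** g"
    using SL2_inverse[OF h_SL2] by (simp add: g(2) flip: matrix_mul_assoc)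
  \<comment> \<open>The adjugate of an element of \<open>Delta \<nn> \<eta>\<close> has bottom row
    \<open>(0, 1)\<close> modulo \<open>\<nn>\<close>, so multiplying by it on the left keeps bottom
    rows.\<close>
  have "adj2 ?\<delta> $ 2 $ 1 \<in> \<nn>" "adj2 ?\<delta> $ 2 $ 2 - 1 \<in> \<nn>"
    using \<delta>(1) by (simp_all add: Delta_def \<nn>_uminus)
  moreover have "(adj2 ?\<delta> ** g)$2$j - g$2$j = adj2 ?\<delta>$2$1 * g$1$j + (adj2 ?\<delta>$2$2 - 1) * g$2$j" for j
    by (simp only: mult2_nth) (simp add: algebra_simps)
  ultimately have sr: "same_row (h ** M) g"
    using mat_detD(1)[OF g(1)] by (simp only: same_row_def hM \<nn>_closed simp_thms)
  have "row_mult \<nn> uv M = row g"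
    using row_mult_uv[of M \<eta>] keys_c M sr row_eq_iff by auto
  then have MS: "M \<in> S" using M g(1) by (auto simp: S_def E_set_eq_rows)
  have "row (lift M) = row (h ** M)" "row (h ** M) = row g"
    using S_D(4)[OF MS] sr by (simp_all only: row_eq_iff)
  then have "same_row (lift M) g" using row_eq_iff by metis
  then have \<gamma>: "lift M ** adj2 g \<in> \<Gamma>" by (rule Gamma1I[OF S_D(3)[OF MS] g(1)])
  have "to_delta M = (lift M ** adj2 g) ** ?\<delta>"
    unfolding to_delta_def hM by (simp add: adj2_mult matrix_mul_assoc)
  then have "coset (to_delta M) = D" using coset_eq[OF \<gamma>] \<delta>(2) by simp
  with MS show "M \<in> ?A" by simp
qed

text \<open>By \<open>fibre\<close> the sum runs over a class modulo \<open>SL2\<close> cut down to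
  the support of \<open>c\<close>, as in \<open>c_sum\<close>.\<close>

lemma fibre_sum:
  assumes D: "D \<in> L"
  shows "(\<Sum>M | M \<in> S \<and> coset (to_delta M) = D.
              Poly_Mapping.single (moebius M P1_inf) (Poly_Mapping.lookup c M)
              - Poly_Mapping.single (moebius M P1_zero) (Poly_Mapping.lookup c M))
           = Poly_Mapping.single P1_inf 1 - Poly_Mapping.single P1_zero 1"
proof -
  have "adj2 h ** adj2 (rep D) \<in> mat_det \<eta>"
    by (rule SL2_mult(1)[OF mat_det_adj2[OF h_SL2] mat_det_adj2[OF Delta_mat_det[OF rep_coset(1)[OF D]]]])
  then have "(\<lambda>g. (adj2 h ** adj2 (rep D)) ** g) ` SL2 \<in> right_quotient (mat_det \<eta>) SL2"
    by (auto simp: right_quotient_def)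
  with c_sum show ?thesis unfolding fibre[OF D] by blast
qed

text \<open>An empty fibre would make the sum in \<open>fibre_sum\<close> vanish. Since
  \<open>S\<close> is finite, so is \<open>L\<close>, and the sum in \<open>hecke_pre\<close> is a
  genuine finite one.\<close>

lemma L_eq: "L = (\<lambda>M. coset (to_delta M)) ` S"
proof (intro equalityI subsetI)
  fix D assume D: "D \<in> L"
  \<comment> \<open>The coefficient at infinity is 1, which differs from 0 in the coefficient
    ring.\<close>
  have ne: "Poly_Mapping.single P1_inf 1 - Poly_Mapping.single P1_zero 1 \<noteq> (0 :: 'k P1 \<Rightarrow>\<^sub>0 'r)"
    by (auto simp: poly_mapping_eq_iff fun_eq_iff lookup_minus lookup_single intro!: exI[of _ P1_inf])
  have "{M \<in> S. coset (to_delta M) = D} \<noteq> {}"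
  proof
    assume "{M \<in> S. coset (to_delta M) = D} = {}"
    from fibre_sum[OF D, unfolded this sum.empty] ne show False by simp
  qed
  then show "D \<in> (\<lambda>M. coset (to_delta M)) ` S" by blast
next
  fix D assume "D \<in> (\<lambda>M. coset (to_delta M)) ` S"
  then show "D \<in> L" using to_delta_Delta by (auto simp: left_quotient_def)
qed

section \<open>Comparison of the two sides on each coset\<close>

definition summand :: "'k^2^2 \<Rightarrow> ('k, 'r) pre_symbol" where
  "summand M = scale (Poly_Mapping.lookup c M) (manin_pre (poly_slash \<rho> (adj2 M) P) (lift M))"

text \<open>With \<open>\<delta> = rep D\<close>, \<open>lift M\<close> maps a point
  \<open>z\<close> to \<open>\<gamma> \<delta> h M z\<close> for some \<open>\<gamma>\<close> in
  \<open>\<Gamma>\<close>, and the polynomials match in the same way. So the summand is the image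
  under \<open>\<gamma>\<close> of the term subtracted from it.\<close>

lemma summand_rel:
  assumes D: "D \<in> L" and M: "M \<in> S" "coset (to_delta M) = D"
  shows "summand M - symb (const2 (Poly_Mapping.lookup c M) * poly_slash \<rho> (rep D ** h) P)
      (moebius (rep D ** h) (moebius M P1_zero)) (moebius (rep D ** h) (moebius M P1_inf))
    \<in> symbol_relations \<rho> k \<Gamma>"
proof -
  let ?\<delta> = "rep D" and ?r = "Poly_Mapping.lookup c M"
  note \<delta> = rep_coset[OF D] and m = S_D[OF M(1)]
  note dh = SL2_mult(2)[OF Delta_mat_det[OF \<delta>(1)] h_SL2]
  obtain \<gamma> where \<gamma>: "\<gamma> \<in> \<Gamma>" "to_delta M = \<gamma> ** ?\<delta>"
    using coset_self[of "to_delta M"] M(2) \<delta>(2) by blast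
  \<comment> \<open>The factor \<open>adj2 h\<close> at the end of \<open>to_delta M\<close> cancels
    against \<open>h\<close>.\<close>
  have eq: "lift M ** adj2 M = \<gamma> ** (?\<delta> ** h)"
  proof -
    have "lift M ** adj2 M = to_delta M ** h"
      using SL2_inverse[OF h_SL2] by (simp add: to_delta_def adj2_mult matrix_mul_rid flip: matrix_mul_assoc)
    then show ?thesis by (simp add: \<gamma>(2) matrix_mul_assoc)
  qed
  have moeb: "moebius (lift M) z = moebius \<gamma> (moebius (?\<delta> ** h) (moebius M z))" for z
  proof -
    have "moebius (lift M) z = moebius (lift M) (moebius (adj2 M) (moebius M z))"
      using mat_detD(2)[OF m(2)] \<eta> by (simp add: moebius_adj2_cancel)
    also have "\<dots> = moebius (lift M ** adj2 M) (moebius M z)"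
      using mat_detD(2)[OF m(2)] \<eta> by (simp add: moebius_mult)
    also have "\<dots> = moebius \<gamma> (moebius (?\<delta> ** h) (moebius M z))"
      unfolding eq using mat_detD(2)[OF dh] \<eta> by (intro moebius_mult) simp
    finally show ?thesis .
  qed
  have pol: "poly_slash \<rho> (lift M) (poly_slash \<rho> (adj2 M) P) = poly_slash \<rho> \<gamma> (poly_slash \<rho> (?\<delta> ** h) P)"
    using poly_slash_mult[OF mat_det_adj2[OF m(2)] m(3)] poly_slash_mult[OF dh Gamma1_SL2[OF \<gamma>(1)]] eq
    by simp
  let ?x = "symb (const2 ?r * poly_slash \<rho> (?\<delta> ** h) P)
      (moebius (?\<delta> ** h) (moebius M P1_zero)) (moebius (?\<delta> ** h) (moebius M P1_inf))"
  have "summand M = symbol_slash \<rho> \<gamma> ?x"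
    unfolding summand_def manin_pre_def moeb pol scale_symb symbol_slash_symb poly_slash_const2_mult ..
  moreover have "?x \<in> carrier (pre_symbols (k - 2))"
    using P by (intro symb_carrier hom_polys_const2_mult poly_slash_hom_polys)
  ultimately show ?thesis using symbol_relations_gens(3)[OF \<gamma>(1)] by metis
qed

text \<open>\<open>symb_sum_rel\<close>, with the action of \<open>rep D ** h\<close> as
  \<open>f\<close>, turns \<open>fibre_sum\<close> into an expression of the Hecke term as a sum
  over the fibre modulo relations; \<open>summand_rel\<close> then replaces its terms one by
  one.\<close>

lemma fibre_rel:
  assumes D: "D \<in> L"
  shows "symbol_slash \<rho> (rep D) (manin_pre P h) - (\<Sum>M | M \<in> S \<and> coset (to_delta M) = D. summand M)
    \<in> symbol_relations \<rho> k \<Gamma>"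
proof -
  let ?\<delta> = "rep D" and ?F = "{M \<in> S. coset (to_delta M) = D}"
  let ?Q = "poly_slash \<rho> (?\<delta> ** h) P"
  let ?x = "\<lambda>M. symb (const2 (Poly_Mapping.lookup c M) * ?Q)
      (moebius (?\<delta> ** h) (moebius M P1_zero)) (moebius (?\<delta> ** h) (moebius M P1_inf))"
  note \<delta> = rep_coset[OF D]
  have s: "symbol_slash \<rho> ?\<delta> (manin_pre P h) = symb ?Q (moebius (?\<delta> ** h) P1_zero) (moebius (?\<delta> ** h) P1_inf)"
    using poly_slash_mult[OF h_SL2 Delta_mat_det[OF \<delta>(1)]] mat_detD(2)[OF h_SL2]
    by (simp add: manin_pre_def symbol_slash_symb moebius_mult)
  have "symb ?Q (moebius (?\<delta> ** h) P1_zero) (moebius (?\<delta> ** h) P1_inf) - (\<Sum>M\<in>?F. ?x M)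
      \<in> symbol_relations \<rho> k \<Gamma>"
    using poly_slash_hom_polys[OF P] fibre_sum[OF D] by (rule symb_sum_rel)
  moreover have "(\<Sum>M\<in>?F. summand M - ?x M) \<in> symbol_relations \<rho> k \<Gamma>"
    using summand_rel[OF D] by (intro symbol_relations_sum) auto
  ultimately have "(symbol_slash \<rho> ?\<delta> (manin_pre P h) - (\<Sum>M\<in>?F. ?x M)) - (\<Sum>M\<in>?F. summand M - ?x M)
      \<in> symbol_relations \<rho> k \<Gamma>"
    unfolding s by (rule symbol_relations_diff)
  then show ?thesis by (simp add: sum_subtractf)
qed

lemma finite_S: "finite S"
  unfolding S_def by simp

lemma hecke_rel: "hecke_pre \<rho> \<nn> \<eta> (manin_pre P h) - (\<Sum>M\<in>S. summand M) \<in> symbol_relations \<rho> k \<Gamma>"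
proof -
  \<comment> \<open>By \<open>L_eq\<close> the fibres over \<open>L\<close> partition
    \<open>S\<close>.\<close>
  have "(\<Sum>M\<in>S. summand M) = (\<Sum>D\<in>L. \<Sum>M | M \<in> S \<and> coset (to_delta M) = D. summand M)"
    using finite_S by (intro sum.group[symmetric]) (simp_all add: L_eq)
  then have "hecke_pre \<rho> \<nn> \<eta> (manin_pre P h) - (\<Sum>M\<in>S. summand M)
     = (\<Sum>D\<in>L. symbol_slash \<rho> (rep D) (manin_pre P h) - (\<Sum>M | M \<in> S \<and> coset (to_delta M) = D. summand M))"
    by (simp add: hecke_pre_def sum_subtractf)
  also have "\<dots> \<in> symbol_relations \<rho> k \<Gamma>"
    by (intro symbol_relations_sum fibre_rel)
  finally show ?thesis .
qed

theorem hecke_manin_symbol_row: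
  "hecke \<rho> k \<nn> \<eta> (manin_symbol_row \<rho> k \<nn> P uv) =
    (\<Oplus>\<^bsub>modular_symbols \<rho> k \<Gamma>\<^esub> M \<in> {M \<in> Poly_Mapping.keys c. row_mult \<nn> uv M \<in> E_set \<nn>}.
         Poly_Mapping.lookup c M \<odot>\<^bsub>modular_symbols \<rho> k \<Gamma>\<^esub>
           manin_symbol_row \<rho> k \<nn>
             (subst2 P (lin_form \<rho> (M$1$1) (M$1$2)) (lin_form \<rho> (M$2$1) (M$2$2)))
             (row_mult \<nn> uv M))" (is "?lhs = ?rhs")
proof -
  \<comment> \<open>The slash action already takes an adjugate, so slashing with
    \<open>adj2 M\<close> substitutes the rows of \<open>M\<close> itself.\<close>
  have sub: "subst2 P (lin_form \<rho> (M$1$1) (M$1$2)) (lin_form \<rho> (M$2$1) (M$2$2))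
     = poly_slash \<rho> (adj2 M) P" for M :: "'k^2^2"
    by (simp add: poly_slash_def del: subst2_lin_form)
  have "?rhs = (\<Oplus>\<^bsub>modular_symbols \<rho> k \<Gamma>\<^esub> M \<in> S. symbol_class \<rho> k \<Gamma> (summand M))"
    unfolding S_def[symmetric] manin_symbol_row_eq modular_symbols_smult sub summand_def lift_def ..
  also have "\<dots> = symbol_class \<rho> k \<Gamma> (\<Sum>M\<in>S. summand M)"
    unfolding summand_def
    by (intro finsum_symbol_class finite_S scale_carrier manin_pre_carrier poly_slash_hom_polys P)
  also have "\<dots> = symbol_class \<rho> k \<Gamma> (hecke_pre \<rho> \<nn> \<eta> (manin_pre P h))"
    using hecke_rel by (simp only: symbol_class_eq_iff[symmetric])
  also have "\<dots> = ?lhs"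
    unfolding manin_symbol_row_eq h_def hecke_symbol_class[OF \<eta>] ..
  finally show ?thesis ..
qed

end

theorem theorem3p2:
  fixes \<rho> :: "'k::field_char_0 \<Rightarrow> 'r::comm_ring_1"
    and \<nn> :: "'k set" and \<eta> :: 'k and k :: nat
    and P :: "'r poly poly" and u v :: "'k set"
    and c :: "'k^2^2 \<Rightarrow>\<^sub>0 'r"
  assumes "imaginary_quadratic_field TYPE('k)"
    and "\<exists>\<phi>. euclidean_domain (int_ring :: 'k ring) \<phi>"
    and "ideal \<nn> int_ring" and "\<nn> \<noteq> {0}"
    and "\<rho> \<in> ring_hom int_ring (set_ring UNIV)"
    and "k \<ge> 2"
    and "\<eta> \<in> carrier int_ring" and "\<eta> \<noteq> 0"
    and "PIdl\<^bsub>int_ring\<^esub> \<eta> <+>\<^bsub>int_ring\<^esub> \<nn> = carrier int_ring"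
    and "P \<in> hom_polys (k - 2)" and "(u, v) \<in> E_set \<nn>"
    and "Poly_Mapping.keys c \<subseteq> mat_det \<eta>"
    and "\<forall>C \<in> right_quotient (mat_det \<eta>) SL2.
           (\<Sum>M \<in> C \<inter> Poly_Mapping.keys c.
              Poly_Mapping.single (moebius M P1_inf) (Poly_Mapping.lookup c M)
              - Poly_Mapping.single (moebius M P1_zero) (Poly_Mapping.lookup c M))
           = Poly_Mapping.single P1_inf 1 - Poly_Mapping.single P1_zero 1"
  shows "hecke \<rho> k \<nn> \<eta> (manin_symbol_row \<rho> k \<nn> P (u, v)) =
    (\<Oplus>\<^bsub>modular_symbols \<rho> k (Gamma1 \<nn>)\<^esub>
       M \<in> {M \<in> Poly_Mapping.keys c. row_mult \<nn> (u, v) M \<in> E_set \<nn>}.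
         Poly_Mapping.lookup c M \<odot>\<^bsub>modular_symbols \<rho> k (Gamma1 \<nn>)\<^esub>
           manin_symbol_row \<rho> k \<nn>
             (subst2 P (lin_form \<rho> (M$1$1) (M$1$2)) (lin_form \<rho> (M$2$1) (M$2$2)))
             (row_mult \<nn> (u, v) M))"
proof -
  \<comment> \<open>A Euclidean domain is principal, which is the form the locale asks for.\<close>
  obtain \<phi> where "euclidean_domain (int_ring :: 'k ring) \<phi>" using assms(2) by blast
  then interpret E: euclidean_domain "int_ring :: 'k ring" \<phi> .
  interpret hecke_setting \<rho> \<nn> \<eta> k P "(u, v)" c
    by (intro hecke_setting.intro modular_setting.intro hecke_setting_axioms.intro)
      (fact assms E.principal_domain_axioms)+
  show ?thesis by (rule hecke_manin_symbol_row)
qed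

end
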